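(* Suppose that $\begin{bmatrix}\tilde V&\tilde E\\0&N\end{bmatrix}\in\mathscr N_{\mathcal K_1,\mathcal K_2}$ is an entrywise extension of $T=\begin{bmatrix} V & E\\ 0 & S\end{bmatrix}\in\mathscr S_{\mathcal H_1,\mathcal H_2}$ satisfying $|E|\subseteq|\tilde E|$, where $N\in B(\mathcal K_2)$ is a minimal normal extension of $S$. Set $\mathcal H_{21}=\ker E$ and $\mathcal H_{22}=\overline{\operatorname{ran}|E|}$. Let $E_j:=E|_{\mathcal H_{2j}}\colon\mathcal H_{2j}\to\mathcal H_1$ for $j=1,2$. Then the following statements hold: (a) $\mathcal H_{2j}$ reduces $S$ and $S_j:=S|_{\mathcal H_{2j}}$ is subnormal for $j=1,2$; (b) $\mathcal H_2=\mathcal H_{21}\oplus\mathcal H_{22}$ and $S=S_1\oplus S_2$; (c) $E(f_1\oplus f_2)=E_1f_1+E_2f_2$ for $f_j\in\mathcal H_{2j}$, $E_1=0$ and $E_2$ is injective. Next, let $N=N_1\oplus N_2$ be the orthogonal decomposition of $N$ with respect to an orthogonal decomposition $\mathcal K_2=\mathcal K_{21}\oplus\mathcal K_{22}$ such that $N_j$ is a minimal normal extension of $S_j$ for $j=1,2$ (such a decomposition exists and is unique). For $j=1,2$, let $\tilde E_j:=\tilde E|_{\mathcal K_{2j}}\colon\mathcal K_{2j}\to\mathcal K_1$. Then for $j=1,2$: (d) $\begin{bmatrix}V&E_j\\0&S_j\end{bmatrix}\in\mathscr S_{\mathcal H_1,\mathcal H_{2j}}$ and $\begin{bmatrix}\tilde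 V&\tilde E_j\\0&N_j\end{bmatrix}\in\mathscr N_{\mathcal K_1,\mathcal K_{2j}}$; (e) $\begin{bmatrix}V&E_j\\0&S_j\end{bmatrix}\preceq\begin{bmatrix}\tilde V&\tilde E_j\\0&N_j\end{bmatrix}$; (f) $|\tilde E_j|$ and $|\tilde E|$ are the lifts of $|E_j|$ and $|E|$ relative to $\{N_j\}'$ and $\{N\}'$, respectively; in particular, $|E_j|\subseteq|\tilde E_j|$; (g) $\tilde E_1=0$ and $\tilde E_2$ is injective.
   Context: All Hilbert spaces are complex; $B(\mathcal H,\mathcal K)$ is the space of bounded linear operators and $B(\mathcal H)=B(\mathcal H,\mathcal H)$; $|E|=(E^*E)^{1/2}$; $\mathscr F'$ denotes the commutant of a set $\mathscr F$ of operators. $A\subseteq B$ means that $B$ extends $A$: the space of $A$ is (isometrically) a subspace of that of $B$, and $Ah=Bh$ for all $h$ in the space of $A$. For nonzero Hilbert spaces $\mathcal H_1,\mathcal H_2$, the operator $\begin{bmatrix}V&E\\0&X\end{bmatrix}\in B(\mathcal H_1\oplus\mathcal H_2)$ is a Brownian-type operator if $V^*V=I$, $V^*E=0$ and $XE^*E=E^*EX$. It belongs to $\mathscr S_{\mathcal H_1,\mathcal H_2}$ (resp. $\mathscr N_{\mathcal H_1,\mathcal H_2}$) if in addition $X$ is subnormal (resp. normal). In (d), if $\mathcal H_{2j}=\{0\}$ (equivalently $\mathcal K_{2j}=\{0\}$), membership in these classes is understood with the same conditions, dropping the requirement that the second space be nonzero. $S\in B(\mathcal H)$ is subnormal if $S\subseteq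 N$ for some normal $N\in B(\mathcal K)$, $\mathcal K\supseteq\mathcal H$ (a normal extension of $S$). The normal extension $N$ is minimal if $\mathcal K$ is the only closed subspace of $\mathcal K$ that contains $\mathcal H$ and reduces $N$. If $N\in B(\mathcal K)$ is a minimal normal extension of $S\in B(\mathcal H)$, $P$ is the orthogonal projection of $\mathcal K$ onto $\mathcal H$, and $A\in\{S,S^*\}'$, then the lift of $A$ relative to $\{N\}'$ is the (unique, always existing) operator $B\in\{N\}'\cap\{P\}'$ with $A\subseteq B$. Entrywise extension: $\begin{bmatrix}A_{11}&A_{12}\\ A_{21}&A_{22}\end{bmatrix}\preceq\begin{bmatrix}\tilde A_{11}&\tilde A_{12}\\ \tilde A_{21}&\tilde A_{22}\end{bmatrix}$ (the latter is an entrywise extension of the former), for operators on $\mathcal H_1\oplus\mathcal H_2$ and $\mathcal K_1\oplus\mathcal K_2$ respectively, means $\mathcal H_j\subseteq\mathcal K_j$ and $A_{ij}h_j=\tilde A_{ij}h_j$ for all $h_j\in\mathcal H_j$ and $i,j\in\{1,2\}$. *)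

theory Defs
  imports "HOL-Analysis.Analysis"
begin

section \<open>Complex inner product spaces\<close>

class scaleC =
  fixes scaleC :: "complex \<Rightarrow> 'a \<Rightarrow> 'a" (infixr "*\<^sub>C" 75)

text \<open>
  The inner product is linear in the first argument. Its real part is the real inner product of
  the type, so norm and topology are those of \<^class>\<open>real_inner\<close>.
  Completeness is not part of the class: Hilbert spaces are complete subspaces.
\<close>

class complex_inner = real_inner + scaleC +
  fixes cinner :: "'a \<Rightarrow> 'a \<Rightarrow> complex"
  assumes scaleC_add_right: "a *\<^sub>C (x + y) = a *\<^sub>C x + a *\<^sub>C y"
    and scaleC_add_left: "(a + b) *\<^sub>C x = a *\<^sub>C x + b *\<^sub>C x"
    and scaleC_scaleC: "a *\<^sub>C b *\<^sub>C x = (a * b) *\<^sub>C x"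
    and scaleC_of_real: "complex_of_real r *\<^sub>C x = r *\<^sub>R x"
    and cinner_commute: "cinner x y = cnj (cinner y x)"
    and cinner_add_left: "cinner (x + y) z = cinner x z + cinner y z"
    and cinner_scaleC_left: "cinner (a *\<^sub>C x) y = a * cinner x y"
    and Re_cinner: "Re (cinner x y) = inner x y"

instantiation complex :: complex_inner
begin
definition "a *\<^sub>C x = a * (x :: complex)"
definition "cinner x y = x * cnj (y :: complex)"
instance
  by standard
    (auto simp: scaleC_complex_def cinner_complex_def algebra_simps inner_complex_def
      scaleR_conv_of_real)
end

instantiation prod :: (complex_inner, complex_inner) complex_inner
begin
definition "a *\<^sub>C x = (a *\<^sub>C fst x, a *\<^sub>C snd x)"
definition "cinner x y = cinner (fst x) (fst y) + cinner (snd x) (snd y)"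
instance
proof
  fix x y :: "'a \<times> 'b"
  show "cinner x y = cnj (cinner y x)"
    unfolding cinner_prod_def complex_cnj_add
    using cinner_commute[of "fst x" "fst y"] cinner_commute[of "snd x" "snd y"] by simp
qed (auto simp: scaleC_prod_def cinner_prod_def scaleC_add_right scaleC_add_left scaleC_scaleC
      scaleC_of_real cinner_add_left cinner_scaleC_left Re_cinner inner_prod_def algebra_simps
      scaleR_prod_def)
end

lemma norm_scaleC: "norm (a *\<^sub>C x) = cmod a * norm (x :: 'a::complex_inner)"
proof -
  have *: "complex_of_real ((norm z)\<^sup>2) = cinner z z" for z :: 'a
  proof (rule complex_eqI)
    have "Im (cinner z z) = - Im (cinner z z)"
      using cinner_commute[of z z] by (metis cnj.simps(2))
    then show "Im (complex_of_real ((norm z)\<^sup>2)) = Im (cinner z z)" by simp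
  qed (simp add: Re_cinner power2_norm_eq_inner)
  have "cinner (a *\<^sub>C x) (a *\<^sub>C x) = a * cnj a * cinner x x"
    using cinner_commute[of x "a *\<^sub>C x"] cinner_commute[of x x] by (simp add: cinner_scaleC_left)
  then have "complex_of_real ((norm (a *\<^sub>C x))\<^sup>2) = complex_of_real ((cmod a * norm x)\<^sup>2)"
    by (simp only: *[symmetric] complex_norm_square[symmetric] power_mult_distrib of_real_mult
        of_real_power)
  then have "(norm (a *\<^sub>C x))\<^sup>2 = (cmod a * norm x)\<^sup>2"
    using of_real_eq_iff by blast
  then show ?thesis by (simp add: power2_eq_iff_nonneg)
qed

lemma cinner_conv_inner: "cinner x y = Complex (inner x y) (inner x (\<i> *\<^sub>C y))"
  for x y :: "'a::complex_inner"
proof -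
  have "cinner x (\<i> *\<^sub>C y) = - \<i> * cinner x y"
    using cinner_commute[of x "\<i> *\<^sub>C y"] cinner_commute[of x y] by (simp add: cinner_scaleC_left)
  then have "inner x (\<i> *\<^sub>C y) = Im (cinner x y)"
    by (simp flip: Re_cinner)
  then show ?thesis by (simp add: complex_eq_iff Re_cinner)
qed


section \<open>Square-summable sequences\<close>

text \<open>
  Only needed as a sufficiently large ambient space in the definition of subnormality.
\<close>

typedef (overloaded) 'a ell2 = "{f :: nat \<Rightarrow> 'a::complex_inner. summable (\<lambda>n. (norm (f n))\<^sup>2)}"
  by (rule exI[of _ "\<lambda>_. 0"]) simp

setup_lifting type_definition_ell2

lemma ell2_add: "summable (\<lambda>n. (norm (f n + g n))\<^sup>2)"
  if "summable (\<lambda>n. (norm (f n))\<^sup>2)" "summable (\<lambda>n. (norm (g n))\<^sup>2)"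
  for f g :: "nat \<Rightarrow> 'a::real_inner"
proof (rule summable_comparison_test')
  show "summable (\<lambda>n. 2 * (norm (f n))\<^sup>2 + 2 * (norm (g n))\<^sup>2)"
    using that by (intro summable_add summable_mult)
  fix n :: nat
  have "(norm (f n + g n))\<^sup>2 + (norm (f n - g n))\<^sup>2 = 2 * (norm (f n))\<^sup>2 + 2 * (norm (g n))\<^sup>2"
    by (simp add: power2_norm_eq_inner inner_add inner_diff inner_commute algebra_simps)
  then show "norm ((norm (f n + g n))\<^sup>2) \<le> 2 * (norm (f n))\<^sup>2 + 2 * (norm (g n))\<^sup>2"
    by (smt (verit) real_norm_def zero_le_power2)
qed

lemma ell2_inner: "summable (\<lambda>n. inner (f n) (g n))"
  if "summable (\<lambda>n. (norm (f n))\<^sup>2)" "summable (\<lambda>n. (norm (g n))\<^sup>2)"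
  for f g :: "nat \<Rightarrow> 'a::real_inner"
proof -
  have "inner (f n) (g n) = ((norm (f n + g n))\<^sup>2 - (norm (f n))\<^sup>2 - (norm (g n))\<^sup>2) / 2" for n
    by (simp add: power2_norm_eq_inner inner_add inner_commute)
  then show ?thesis
    by (simp only:) (intro summable_divide summable_diff ell2_add that)
qed

lemma ell2_scaleC: "summable (\<lambda>n. (norm (a *\<^sub>C f n))\<^sup>2)"
  if "summable (\<lambda>n. (norm (f n))\<^sup>2)" for f :: "nat \<Rightarrow> 'a::complex_inner"
  using that by (simp add: norm_scaleC power_mult_distrib summable_mult)

lemma ell2_cinner: "summable (\<lambda>n. cinner (f n) (g n))"
  if "summable (\<lambda>n. (norm (f n))\<^sup>2)" "summable (\<lambda>n. (norm (g n))\<^sup>2)"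
  for f g :: "nat \<Rightarrow> 'a::complex_inner"
  using ell2_inner[OF that] ell2_inner[OF that(1) ell2_scaleC[OF that(2), of \<i>]]
  by (subst summable_complex_iff) (simp add: cinner_conv_inner)

instantiation ell2 :: (complex_inner) real_inner
begin
lift_definition zero_ell2 :: "'a ell2" is "\<lambda>_. 0" by simp
lift_definition plus_ell2 :: "'a ell2 \<Rightarrow> 'a ell2 \<Rightarrow> 'a ell2" is "\<lambda>f g n. f n + g n"
  by (rule ell2_add)
lift_definition uminus_ell2 :: "'a ell2 \<Rightarrow> 'a ell2" is "\<lambda>f n. - f n" by simp
lift_definition minus_ell2 :: "'a ell2 \<Rightarrow> 'a ell2 \<Rightarrow> 'a ell2" is "\<lambda>f g n. f n - g n"
  using ell2_add[where g = "\<lambda>n. - g n" for g] by fastforce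
lift_definition scaleR_ell2 :: "real \<Rightarrow> 'a ell2 \<Rightarrow> 'a ell2" is "\<lambda>r f n. r *\<^sub>R f n"
  by (simp add: power_mult_distrib summable_mult)
lift_definition inner_ell2 :: "'a ell2 \<Rightarrow> 'a ell2 \<Rightarrow> real" is "\<lambda>f g. \<Sum>n. inner (f n) (g n)" .
definition "norm (x :: 'a ell2) = sqrt (inner x x)"
definition "sgn (x :: 'a ell2) = inverse (norm x) *\<^sub>R x"
definition "dist x y = norm (x - y :: 'a ell2)"
definition [code del]:
  "(uniformity :: ('a ell2 \<times> 'a ell2) filter) = (INF e\<in>{0 <..}. principal {(x, y). dist x y < e})"
definition [code del]:
  "open (U :: 'a ell2 set) \<longleftrightarrow> (\<forall>x\<in>U. \<forall>\<^sub>F (x', y) in uniformity. x' = x \<longrightarrow> y \<in> U)"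
instance
proof
  fix x y z :: "'a ell2" and r s :: real
  show "x + y + z = x + (y + z)" "x + y = y + x" "0 + x = x" "- x + x = 0" "x - y = x + - y"
    by (transfer; simp add: algebra_simps)+
  show "r *\<^sub>R (x + y) = r *\<^sub>R x + r *\<^sub>R y" "(r + s) *\<^sub>R x = r *\<^sub>R x + s *\<^sub>R x"
    "r *\<^sub>R s *\<^sub>R x = (r * s) *\<^sub>R x" "1 *\<^sub>R x = x"
    by (transfer; simp add: algebra_simps)+
  show "inner x y = inner y x"
    by transfer (simp add: inner_commute)
  show "inner (x + y) z = inner x z + inner y z"
    by transfer (simp add: inner_add suminf_add ell2_inner)
  show "inner (r *\<^sub>R x) y = r * inner x y"
    by transfer (simp add: suminf_mult ell2_inner)
  show "0 \<le> inner x x"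
    by transfer (simp add: suminf_nonneg ell2_inner)
  show "inner x x = 0 \<longleftrightarrow> x = 0"
    by transfer (auto simp: suminf_eq_zero_iff ell2_inner fun_eq_iff)
qed (simp_all add: norm_ell2_def sgn_ell2_def dist_ell2_def uniformity_ell2_def open_ell2_def)
end

instantiation ell2 :: (complex_inner) complex_inner
begin
lift_definition scaleC_ell2 :: "complex \<Rightarrow> 'a ell2 \<Rightarrow> 'a ell2" is "\<lambda>a f n. a *\<^sub>C f n"
  by (rule ell2_scaleC)
lift_definition cinner_ell2 :: "'a ell2 \<Rightarrow> 'a ell2 \<Rightarrow> complex" is "\<lambda>f g. \<Sum>n. cinner (f n) (g n)" .
instance
proof
  fix x y z :: "'a ell2" and a b :: complex and r :: real
  show "a *\<^sub>C (x + y) = a *\<^sub>C x + a *\<^sub>C y" "(a + b) *\<^sub>C x = a *\<^sub>C x + b *\<^sub>C x"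
    "a *\<^sub>C b *\<^sub>C x = (a * b) *\<^sub>C x" "complex_of_real r *\<^sub>C x = r *\<^sub>R x"
    by (transfer; simp add: scaleC_add_right scaleC_add_left scaleC_scaleC scaleC_of_real)+
  show "cinner x y = cnj (cinner y x)"
  proof transfer
    fix f g :: "nat \<Rightarrow> 'a"
    assume *: "summable (\<lambda>n. (norm (f n))\<^sup>2)" "summable (\<lambda>n. (norm (g n))\<^sup>2)"
    have "(\<lambda>n. cnj (cinner (g n) (f n))) sums cnj (\<Sum>n. cinner (g n) (f n))"
      using ell2_cinner[OF *(2,1)] by (simp only: sums_cnj summable_sums)
    then show "(\<Sum>n. cinner (f n) (g n)) = cnj (\<Sum>n. cinner (g n) (f n))"
      using sums_unique by (subst cinner_commute) fastforce
  qed
  show "cinner (x + y) z = cinner x z + cinner y z"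
    by transfer (simp add: cinner_add_left suminf_add ell2_cinner)
  show "cinner (a *\<^sub>C x) y = a * cinner x y"
    by transfer (simp add: cinner_scaleC_left suminf_mult ell2_cinner)
  show "Re (cinner x y) = inner x y"
    by transfer (simp add: Re_suminf ell2_cinner Re_cinner)
qed
end


section \<open>Hilbert spaces and bounded operators\<close>

text \<open>
  A Hilbert space is a complete complex subspace of an ambient type of class
  \<^class>\<open>complex_inner\<close>; a space contained in another one is a subset of it. An operator between
  two such spaces is a function of which only the values on its domain matter, so equality of
  operators always means equality on the domain.
\<close>

definition hilbert_space :: "'a::complex_inner set \<Rightarrow> bool" where
  "hilbert_space H \<longleftrightarrow>
     0 \<in> H \<and> (\<forall>x\<in>H. \<forall>y\<in>H. x + y \<in> H) \<and> (\<forall>a. \<forall>x\<in>H. a *\<^sub>C x \<in> H) \<and> complete H"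

definition bops :: "'a::complex_inner set \<Rightarrow> 'b::complex_inner set \<Rightarrow> ('a \<Rightarrow> 'b) set" where
  "bops H K = {A. A ` H \<subseteq> K \<and>
     (\<forall>x\<in>H. \<forall>y\<in>H. A (x + y) = A x + A y) \<and>
     (\<forall>a. \<forall>x\<in>H. A (a *\<^sub>C x) = a *\<^sub>C A x) \<and>
     (\<exists>M. \<forall>x\<in>H. norm (A x) \<le> M * norm x)}"

definition adj :: "'a::complex_inner set \<Rightarrow> 'b::complex_inner set \<Rightarrow> ('a \<Rightarrow> 'b) \<Rightarrow> 'b \<Rightarrow> 'a" where
  "adj H K A = restrict (\<lambda>y. THE x. x \<in> H \<and> (\<forall>h\<in>H. cinner (A h) y = cinner h x)) K"

definition positive_op :: "'a::complex_inner set \<Rightarrow> ('a \<Rightarrow> 'a) \<Rightarrow> bool" where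
  "positive_op H A \<longleftrightarrow> A \<in> bops H H \<and> (\<forall>x\<in>H. cinner (A x) x \<in> \<real> \<and> 0 \<le> Re (cinner (A x) x))"

text \<open>
  The positive square root is unique as an operator on \<open>H\<close>; extensionality makes it unique as a
  function.
\<close>

definition op_sqrt :: "'a::complex_inner set \<Rightarrow> ('a \<Rightarrow> 'a) \<Rightarrow> 'a \<Rightarrow> 'a" where
  "op_sqrt H A = (THE R. R \<in> extensional H \<and> positive_op H R \<and> (\<forall>x\<in>H. R (R x) = A x))"

definition op_abs :: "'a::complex_inner set \<Rightarrow> 'b::complex_inner set \<Rightarrow> ('a \<Rightarrow> 'b) \<Rightarrow> 'a \<Rightarrow> 'a" where
  "op_abs H K E = op_sqrt H (adj H K E \<circ> E)"

definition normal_op :: "'a::complex_inner set \<Rightarrow> ('a \<Rightarrow> 'a) \<Rightarrow> bool" where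
  "normal_op K N \<longleftrightarrow> N \<in> bops K K \<and> (\<forall>x\<in>K. adj K K N (N x) = N (adj K K N x))"

definition commutant :: "'a::complex_inner set \<Rightarrow> ('a \<Rightarrow> 'a) set \<Rightarrow> ('a \<Rightarrow> 'a) set" where
  "commutant H F = {A \<in> bops H H. \<forall>B\<in>F. \<forall>x\<in>H. A (B x) = B (A x)}"

definition orth_proj :: "'a::complex_inner set \<Rightarrow> 'a set \<Rightarrow> 'a \<Rightarrow> 'a" where
  "orth_proj K H = restrict (\<lambda>x. THE p. p \<in> H \<and> (\<forall>h\<in>H. cinner (x - p) h = 0)) K"

definition reduces :: "'a::complex_inner set \<Rightarrow> ('a \<Rightarrow> 'a) \<Rightarrow> 'a set \<Rightarrow> bool" where
  "reduces K A L \<longleftrightarrow> hilbert_space L \<and> L \<subseteq> K \<and> A ` L \<subseteq> L \<and>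
     (let L' = {x \<in> K. \<forall>y\<in>L. cinner x y = 0} in A ` L' \<subseteq> L')"

definition orth_decomp :: "'a::complex_inner set \<Rightarrow> 'a set \<Rightarrow> 'a set \<Rightarrow> bool" where
  "orth_decomp H H1 H2 \<longleftrightarrow> hilbert_space H1 \<and> hilbert_space H2 \<and>
     (\<forall>x\<in>H1. \<forall>y\<in>H2. cinner x y = 0) \<and> H = {x + y | x y. x \<in> H1 \<and> y \<in> H2}"

text \<open>\<open>A = A1 \<oplus> A2\<close>, for spaces \<open>H1\<close>, \<open>H2\<close> that form an orthogonal decomposition.\<close>

definition op_sum ::
  "'a::complex_inner set \<Rightarrow> 'a set \<Rightarrow> ('a \<Rightarrow> 'a) \<Rightarrow> ('a \<Rightarrow> 'a) \<Rightarrow> ('a \<Rightarrow> 'a) \<Rightarrow> bool" where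
  "op_sum H1 H2 A A1 A2 \<longleftrightarrow> A1 \<in> bops H1 H1 \<and> A2 \<in> bops H2 H2 \<and>
     (\<forall>x\<in>H1. \<forall>y\<in>H2. A (x + y) = A1 x + A2 y)"

definition extends :: "'a::complex_inner set \<Rightarrow> ('a \<Rightarrow> 'a) \<Rightarrow> 'a set \<Rightarrow> ('a \<Rightarrow> 'a) \<Rightarrow> bool" where
  "extends H A K B \<longleftrightarrow> H \<subseteq> K \<and> (\<forall>h\<in>H. A h = B h)"


section \<open>Subnormal operators and lifts\<close>

definition isometric_embedding ::
  "'a::complex_inner set \<Rightarrow> 'b::complex_inner set \<Rightarrow> ('a \<Rightarrow> 'b) \<Rightarrow> bool" where
  "isometric_embedding H K J \<longleftrightarrow> J \<in> bops H K \<and> (\<forall>h\<in>H. norm (J h) = norm h)"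

text \<open>
  The ambient type of \<open>H\<close> may be too small to contain a normal extension of \<open>S\<close>, so here \<open>H\<close> is
  identified with its image under an isometric embedding into the larger space. Taking that space
  inside \<open>'a ell2\<close> is no restriction: a minimal normal extension of \<open>S\<close> acts on the closed
  span of the vectors \<open>(N\<^sup>*)\<^sup>n h\<close> with \<open>h \<in> H\<close>, whose Hilbert dimension is at most that of the
  Hilbert space of square-summable sequences in \<open>H\<close>, a complete subspace of \<open>'a ell2\<close>.
\<close>

definition subnormal :: "'a::complex_inner set \<Rightarrow> ('a \<Rightarrow> 'a) \<Rightarrow> bool" where
  "subnormal H S \<longleftrightarrow> S \<in> bops H H \<and>
     (\<exists>(K :: 'a ell2 set) N J. hilbert_space K \<and> normal_op K N \<and>
        isometric_embedding H K J \<and> (\<forall>h\<in>H. J (S h) = N (J h)))"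

definition minimal_normal_extension ::
  "'a::complex_inner set \<Rightarrow> ('a \<Rightarrow> 'a) \<Rightarrow> 'a set \<Rightarrow> ('a \<Rightarrow> 'a) \<Rightarrow> bool" where
  "minimal_normal_extension H S K N \<longleftrightarrow>
     hilbert_space H \<and> S \<in> bops H H \<and> hilbert_space K \<and> normal_op K N \<and> extends H S K N \<and>
     (\<forall>L. H \<subseteq> L \<and> reduces K N L \<longrightarrow> L = K)"

definition lifts ::
  "'a::complex_inner set \<Rightarrow> ('a \<Rightarrow> 'a) \<Rightarrow> 'a set \<Rightarrow> ('a \<Rightarrow> 'a) \<Rightarrow> ('a \<Rightarrow> 'a) set" where
  "lifts H A K N = {B \<in> commutant K {N} \<inter> commutant K {orth_proj K H}. extends H A K B}"

definition is_lift ::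
  "'a::complex_inner set \<Rightarrow> ('a \<Rightarrow> 'a) \<Rightarrow> 'a set \<Rightarrow> ('a \<Rightarrow> 'a) \<Rightarrow> ('a \<Rightarrow> 'a) \<Rightarrow> ('a \<Rightarrow> 'a) \<Rightarrow> bool" where
  "is_lift H S K N A B \<longleftrightarrow>
     minimal_normal_extension H S K N \<and> A \<in> commutant H {S, adj H H S} \<and>
     B \<in> lifts H A K N \<and> (\<forall>B'\<in>lifts H A K N. \<forall>x\<in>K. B' x = B x)"


section \<open>Operator matrices and Brownian-type operators\<close>

datatype ('a, 'b) opmat =
  OpMat (m11: "'a \<Rightarrow> 'a") (m12: "'b \<Rightarrow> 'a") (m21: "'a \<Rightarrow> 'b") (m22: "'b \<Rightarrow> 'b")

definition mat_op :: "('a::plus, 'b::plus) opmat \<Rightarrow> 'a \<times> 'b \<Rightarrow> 'a \<times> 'b" where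
  "mat_op M = (\<lambda>(x, y). (m11 M x + m12 M y, m21 M x + m22 M y))"

definition upper_mat ::
  "('a \<Rightarrow> 'a) \<Rightarrow> ('b \<Rightarrow> 'a) \<Rightarrow> ('b \<Rightarrow> 'b) \<Rightarrow> ('a, 'b::zero) opmat" where
  "upper_mat V E X = OpMat V E (\<lambda>_. 0) X"

text \<open>The suffix \<open>0\<close> marks that the second space is allowed to be zero.\<close>

definition brownian_type0 ::
  "'a::complex_inner set \<Rightarrow> 'b::complex_inner set \<Rightarrow> ('a, 'b) opmat set" where
  "brownian_type0 H1 H2 = {M. \<exists>V E X. M = upper_mat V E X \<and>
     hilbert_space H1 \<and> hilbert_space H2 \<and> H1 \<noteq> {0} \<and>
     mat_op M \<in> bops (H1 \<times> H2) (H1 \<times> H2) \<and>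
     (\<forall>x\<in>H1. adj H1 H1 V (V x) = x) \<and>
     (\<forall>y\<in>H2. adj H1 H1 V (E y) = 0) \<and>
     (\<forall>y\<in>H2. X (adj H2 H1 E (E y)) = adj H2 H1 E (E (X y)))}"

definition class_S0 where
  "class_S0 H1 H2 = {M \<in> brownian_type0 H1 H2. subnormal H2 (m22 M)}"

definition class_N0 where
  "class_N0 H1 H2 = {M \<in> brownian_type0 H1 H2. normal_op H2 (m22 M)}"

definition class_S where
  "class_S H1 H2 = {M \<in> class_S0 H1 H2. H2 \<noteq> {0}}"

definition class_N where
  "class_N H1 H2 = {M \<in> class_N0 H1 H2. H2 \<noteq> {0}}"

definition entrywise_ext ::
  "'a set \<Rightarrow> 'b set \<Rightarrow> ('a, 'b) opmat \<Rightarrow> 'a set \<Rightarrow> 'b set \<Rightarrow> ('a, 'b) opmat \<Rightarrow> bool" where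
  "entrywise_ext H1 H2 A K1 K2 B \<longleftrightarrow> H1 \<subseteq> K1 \<and> H2 \<subseteq> K2 \<and>
     (\<forall>h\<in>H1. m11 A h = m11 B h) \<and> (\<forall>h\<in>H2. m12 A h = m12 B h) \<and>
     (\<forall>h\<in>H1. m21 A h = m21 B h) \<and> (\<forall>h\<in>H2. m22 A h = m22 B h)"

text \<open>
  \<open>K1\<close>, \<open>K2\<close> form the orthogonal decomposition of \<open>K\<close> for which \<open>N = N1 \<oplus> N2\<close> with \<open>Nj\<close> a
  minimal normal extension of \<open>Sj\<close>; such \<open>Nj\<close> is necessarily the restriction of \<open>N\<close> to \<open>Kj\<close>.
\<close>

definition min_normal_decomp ::
  "'a::complex_inner set \<Rightarrow> ('a \<Rightarrow> 'a) \<Rightarrow> 'a set \<Rightarrow> ('a \<Rightarrow> 'a) \<Rightarrow>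
   'a set \<Rightarrow> ('a \<Rightarrow> 'a) \<Rightarrow> 'a set \<Rightarrow> 'a set \<Rightarrow> bool" where
  "min_normal_decomp H1 S1 H2 S2 K N K1 K2 \<longleftrightarrow>
     orth_decomp K K1 K2 \<and> op_sum K1 K2 N (restrict N K1) (restrict N K2) \<and>
     minimal_normal_extension H1 S1 K1 (restrict N K1) \<and>
     minimal_normal_extension H2 S2 K2 (restrict N K2)"

end

theory Submission
  imports Defs
begin

text \<open>
  The modulus \<open>|E|\<close> commutes with \<open>S\<close>, and \<open>|E'|\<close> with \<open>N\<close>, because square roots of positive
  operators are limits of polynomials. Hence the kernel and the closed range of \<open>|E'|\<close> reduce \<open>N\<close>,
  and as \<open>|E'|\<close> extends \<open>|E|\<close> they contain \<open>H21\<close> and \<open>H22\<close>, respectively. The minimality of \<open>N\<close>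
  forces the restrictions of \<open>N\<close> to be minimal over the restrictions of \<open>S\<close>, and minimality on both
  sides makes the decomposition unique, so \<open>K21\<close> is the kernel of \<open>E'\<close> and \<open>K22\<close> the closed range of
  \<open>|E'|\<close>. Moduli restrict to reducing subspaces, which gives the statements on lifts.
\<close>

section \<open>Complex inner products\<close>

text \<open>\<open>adj\<close>, \<open>orth_proj\<close> and \<open>op_abs\<close> are definite
  descriptions on complete subspaces of an ambient type that may itself be incomplete, so each needs
  existence and uniqueness on its subspace before anything can be said about it. They rest on the
  Riesz representation theorem and an explicit square-root iteration. The iteration gives more than
  a root: a root commuting with every bounded operator that commutes with the original one. This one
  property yields both the uniqueness of the root and the commutation of moduli with S and N. As a
  modulus is Hermitian, it then also commutes with their adjoints, which turns invariant kernels and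
  closed ranges into reducing ones. Minimality passes to the summands because a part of K21 that is
  orthogonal to H21 is orthogonal to H22 as well, since K22 contains H22. A further obstacle is that
  boundedness and linearity are required only of the whole matrix operator, so those of its entries
  have to be extracted first.\<close>

lemma scaleC_zero_left [simp]: "0 *\<^sub>C x = (0 :: 'a::complex_inner)"
  using scaleC_of_real[of 0 x] by simp

lemma scaleC_zero_right [simp]: "a *\<^sub>C 0 = (0 :: 'a::complex_inner)"
  using scaleC_add_right[of a 0 "0::'a"] by simp

lemma scaleC_minus1: "(-1) *\<^sub>C x = - (x :: 'a::complex_inner)"
  using scaleC_of_real[of "-1" x] by simp

lemma scaleC_minus_right: "a *\<^sub>C (- x) = - (a *\<^sub>C (x :: 'a::complex_inner))"
  using scaleC_add_right[of a x "-x"] by (simp add: eq_neg_iff_add_eq_0 add.commute)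

lemma scaleC_diff_right: "a *\<^sub>C (x - y) = a *\<^sub>C x - a *\<^sub>C (y :: 'a::complex_inner)"
  using scaleC_add_right[of a x "-y"] by (simp add: scaleC_minus_right)

lemma scaleR_scaleC: "r *\<^sub>R a *\<^sub>C x = a *\<^sub>C r *\<^sub>R (x :: 'a::complex_inner)"
  by (simp flip: scaleC_of_real add: scaleC_scaleC mult.commute)

lemma bounded_linear_scaleC: "bounded_linear (\<lambda>x :: 'a::complex_inner. a *\<^sub>C x)"
proof (rule bounded_linear_intro)
  show "a *\<^sub>C (r *\<^sub>R x) = r *\<^sub>R (a *\<^sub>C x)" for r and x :: 'a
    by (simp add: scaleR_scaleC)
  show "norm (a *\<^sub>C x) \<le> norm x * cmod a" for x :: 'a
    by (simp add: norm_scaleC)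
qed (rule scaleC_add_right)

lemma cinner_add_right: "cinner x (y + z) = cinner x y + cinner x (z :: 'a::complex_inner)"
  by (metis cinner_add_left cinner_commute complex_cnj_add)

lemma cinner_scaleC_right: "cinner x (a *\<^sub>C y) = cnj a * cinner x (y :: 'a::complex_inner)"
  by (metis cinner_scaleC_left cinner_commute complex_cnj_mult)

lemma cinner_zero_left [simp]: "cinner 0 (x :: 'a::complex_inner) = 0"
  using cinner_add_left[of 0 0 x] by simp

lemma cinner_zero_right [simp]: "cinner (x :: 'a::complex_inner) 0 = 0"
  using cinner_add_right[of x 0 0] by simp

lemma cinner_minus_left: "cinner (- x) y = - cinner x (y :: 'a::complex_inner)"
  using cinner_add_left[of x "-x" y] by (simp add: eq_neg_iff_add_eq_0 add.commute)

lemma cinner_minus_right: "cinner x (- y) = - cinner x (y :: 'a::complex_inner)"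
  using cinner_add_right[of x y "-y"] by (simp add: eq_neg_iff_add_eq_0 add.commute)

lemma cinner_diff_left: "cinner (x - y) z = cinner x z - cinner y (z :: 'a::complex_inner)"
  using cinner_add_left[of x "-y" z] by (simp add: cinner_minus_left)

lemma cinner_diff_right: "cinner x (y - z) = cinner x y - cinner x (z :: 'a::complex_inner)"
  using cinner_add_right[of x y "-z"] by (simp add: cinner_minus_right)

lemma cinner_scaleR_left: "cinner (r *\<^sub>R x) y = of_real r * cinner x (y :: 'a::complex_inner)"
  by (metis cinner_scaleC_left scaleC_of_real)

lemma cinner_scaleR_right: "cinner x (r *\<^sub>R y) = of_real r * cinner x (y :: 'a::complex_inner)"
  by (metis cinner_scaleC_right scaleC_of_real complex_cnj_complex_of_real)

lemma cinner_self: "cinner x x = of_real ((norm (x :: 'a::complex_inner))\<^sup>2)"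
proof (rule complex_eqI)
  have "Im (cinner x x) = - Im (cinner x x)"
    using cinner_commute[of x x] by (metis cnj.simps(2))
  then show "Im (cinner x x) = Im (complex_of_real ((norm x)\<^sup>2))" by simp
qed (simp add: Re_cinner power2_norm_eq_inner)

lemma cinner_self_eq_0 [simp]: "cinner x x = 0 \<longleftrightarrow> x = (0 :: 'a::complex_inner)"
  by (simp add: cinner_self)

lemma cinner_eq_0_sym: "cinner x y = 0 \<Longrightarrow> cinner y (x :: 'a::complex_inner) = 0"
  by (metis cinner_commute complex_cnj_zero)

text \<open>Multiplying x by a unimodular factor makes the inner product real and nonnegative, and
  the real Cauchy-Schwarz inequality applies.\<close>

lemma norm_cinner_le: "cmod (cinner x y) \<le> norm x * norm (y :: 'a::complex_inner)"
proof (cases "cinner x y = 0")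
  case False
  define a where "a = cnj (cinner x y) / cmod (cinner x y)"
  have "a * cinner x y = of_real (cmod (cinner x y))"
    using False complex_norm_square[of "cinner x y"] by (simp add: a_def field_simps power2_eq_square)
  then have "cmod (cinner x y) = inner (a *\<^sub>C x) y"
    by (metis Re_cinner Re_complex_of_real cinner_scaleC_left)
  also have "\<dots> \<le> norm (a *\<^sub>C x) * norm y"
    by (rule norm_cauchy_schwarz)
  also have "norm (a *\<^sub>C x) = norm x"
    using False by (simp add: norm_scaleC a_def norm_divide)
  finally show ?thesis .
qed simp

lemma bounded_bilinear_cinner:
  "bounded_bilinear (cinner :: 'a::complex_inner \<Rightarrow> 'a \<Rightarrow> complex)"
  by (rule bounded_bilinear.intro)
    (auto simp: cinner_add_left cinner_add_right cinner_scaleR_left cinner_scaleR_right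
      scaleR_conv_of_real intro!: exI[of _ 1] norm_cinner_le)

lemmas tendsto_cinner = bounded_bilinear.tendsto[OF bounded_bilinear_cinner]

section \<open>Subspaces, projections and adjoints\<close>

lemma hilbert_space_zero: "hilbert_space H \<Longrightarrow> 0 \<in> H"
  and hilbert_space_add: "hilbert_space H \<Longrightarrow> x \<in> H \<Longrightarrow> y \<in> H \<Longrightarrow> x + y \<in> H"
  and hilbert_space_scaleC: "hilbert_space H \<Longrightarrow> x \<in> H \<Longrightarrow> a *\<^sub>C x \<in> H"
  and hilbert_space_complete: "hilbert_space H \<Longrightarrow> complete H"
  by (auto simp: hilbert_space_def)

lemma hilbert_space_scaleR: "hilbert_space H \<Longrightarrow> x \<in> H \<Longrightarrow> r *\<^sub>R x \<in> H"
  by (metis hilbert_space_scaleC scaleC_of_real)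

lemma hilbert_space_minus: "hilbert_space H \<Longrightarrow> x \<in> H \<Longrightarrow> - x \<in> H"
  by (metis hilbert_space_scaleC scaleC_minus1)

lemma hilbert_space_diff: "hilbert_space H \<Longrightarrow> x \<in> H \<Longrightarrow> y \<in> H \<Longrightarrow> x - y \<in> H"
  by (metis hilbert_space_add hilbert_space_minus diff_conv_add_uminus)

lemma hilbert_space_closed: "hilbert_space H \<Longrightarrow> closed H"
  by (simp add: complete_imp_closed hilbert_space_complete)

lemmas hilbert_space_intros = hilbert_space_zero hilbert_space_add hilbert_space_scaleC
  hilbert_space_scaleR hilbert_space_minus hilbert_space_diff

lemma hilbert_space_eqI:
  assumes "hilbert_space H" "x \<in> H" "y \<in> H" "\<And>h. h \<in> H \<Longrightarrow> cinner h x = cinner h y"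
  shows "x = y"
proof -
  have "cinner (x - y) (x - y) = 0"
    using assms by (subst cinner_diff_right) (simp add: hilbert_space_diff)
  then show ?thesis by simp
qed

section \<open>Riesz representation and adjoints\<close>

text \<open>The representing vector is the minimiser over H of half the squared norm minus f. With
  this variational route the projection theorem can be derived from Riesz instead of preceding
  it.\<close>

lemma riesz_real:
  fixes H :: "'a::complex_inner set" and f :: "'a \<Rightarrow> real"
  assumes H: "hilbert_space H"
    and add: "\<And>x y. x \<in> H \<Longrightarrow> y \<in> H \<Longrightarrow> f (x + y) = f x + f y"
    and scale: "\<And>r x. x \<in> H \<Longrightarrow> f (r *\<^sub>R x) = r * f x"
    and bound: "\<And>x. x \<in> H \<Longrightarrow> \<bar>f x\<bar> \<le> M * norm x"
  shows "\<exists>x\<in>H. \<forall>h\<in>H. f h = inner h x"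
proof -
  define J where "J x = (norm x)\<^sup>2 / 2 - f x" for x
  have f_diff: "f (x - y) = f x - f y" if "x \<in> H" "y \<in> H" for x y
    using add[of x "- y"] scale[of y "-1"] that by (simp add: hilbert_space_minus H)
  have "- (M\<^sup>2 / 2) \<le> J x" if "x \<in> H" for x
    using bound[OF that] zero_le_power2[of "norm x - M"]
    by (simp add: J_def power2_eq_square algebra_simps)
  then have bdd: "bdd_below (J ` H)" by (meson bdd_belowI2)
  define m where "m = Inf (J ` H)"
  have m_le: "m \<le> J x" if "x \<in> H" for x
    unfolding m_def using bdd that by (rule cINF_lower)
  have "\<exists>x\<in>H. J x < m + 1 / Suc n" for n
  proof -
    have "J ` H \<noteq> {}" using hilbert_space_zero[OF H] by auto
    moreover have "Inf (J ` H) < m + 1 / Suc n" by (simp add: m_def)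
    ultimately show ?thesis using cInf_lessD[of "J ` H"] by blast
  qed
  then obtain X where X: "\<And>n. X n \<in> H" "\<And>n. J (X n) < m + 1 / Suc n"
    by metis
  \<comment> \<open>Parallelogram law: the midpoint of x and y lies in H, so J is at least m there.
    This makes the minimising sequence Cauchy.\<close>
  have par: "(norm (x - y))\<^sup>2 / 4 \<le> J x + J y - 2 * m" if "x \<in> H" "y \<in> H" for x y
  proof -
    have "m \<le> J ((1/2) *\<^sub>R (x + y))"
      by (rule m_le) (simp add: H hilbert_space_intros that)
    moreover have "f ((1/2) *\<^sub>R (x + y)) = (f x + f y) / 2"
      using that by (simp only: scale add H hilbert_space_add)
    moreover have "(norm ((1/2) *\<^sub>R (x + y)))\<^sup>2 = (norm x)\<^sup>2 / 2 + (norm y)\<^sup>2 / 2 - (norm (x - y))\<^sup>2 / 4"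
      by (simp add: power2_norm_eq_inner inner_add inner_diff inner_commute algebra_simps
          power_mult_distrib power_divide) (simp add: field_simps inner_commute)
    ultimately show ?thesis unfolding J_def by argo
  qed
  have "Cauchy X"
  proof (rule metric_CauchyI)
    fix e :: real assume "0 < e"
    \<comment> \<open>The 8 is the 4 from \<open>par\<close> times the two excesses of J over m,
      each below 1 / Suc n0.\<close>
    obtain n0 where n0: "1 / real (Suc n0) < e\<^sup>2 / 8"
      using \<open>0 < e\<close> by (metis nat_approx_posE zero_less_divide_iff zero_less_numeral zero_less_power)
    have "dist (X i) (X j) < e" if "n0 \<le> i" "n0 \<le> j" for i j
    proof -
      have "1 / real (Suc i) \<le> 1 / Suc n0" "1 / real (Suc j) \<le> 1 / Suc n0"
        using that by (simp_all add: field_simps)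
      then have "(norm (X i - X j))\<^sup>2 < e\<^sup>2"
        using par[OF X(1) X(1), of i j] X(2)[of i] X(2)[of j] n0 by linarith
      then show ?thesis
        using \<open>0 < e\<close> by (simp add: dist_norm power_less_imp_less_base)
    qed
    then show "\<exists>n. \<forall>i\<ge>n. \<forall>j\<ge>n. dist (X i) (X j) < e" by blast
  qed
  then obtain x where x: "x \<in> H" "X \<longlonglongrightarrow> x"
    using hilbert_space_complete[OF H] X(1) unfolding complete_def by blast
  have "(\<lambda>n. f (X n)) \<longlonglongrightarrow> f x"
  proof (rule LIM_zero_cancel, rule Lim_null_comparison)
    show "\<forall>\<^sub>F n in sequentially. norm (f (X n) - f x) \<le> M * norm (X n - x)"
      using bound[of "X n - x" for n] x X by (simp add: f_diff H hilbert_space_diff)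
    show "(\<lambda>n. M * norm (X n - x)) \<longlonglongrightarrow> 0"
      by (rule tendsto_mult_right_zero) (use x(2) LIM_zero tendsto_norm_zero in blast)
  qed
  then have "(\<lambda>n. J (X n)) \<longlonglongrightarrow> J x"
    unfolding J_def by (intro tendsto_intros x) auto
  moreover have "(\<lambda>n. m + 1 / Suc n) \<longlonglongrightarrow> m + 0"
    by (intro tendsto_intros) (rule LIMSEQ_Suc[OF lim_1_over_n])
  ultimately have Jx: "J x \<le> m"
    using X(2) by (intro LIMSEQ_le) (auto intro: less_imp_le)
  have "f h = inner h x" if "h \<in> H" for h
  proof -
    \<comment> \<open>Compare J at the minimiser x with J at x + t h. The right-hand side is a
      quadratic in t that vanishes at 0, so its linear coefficient must be zero.\<close>
    have *: "0 \<le> t\<^sup>2 * (norm h)\<^sup>2 / 2 + t * (inner h x - f h)" for t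
    proof -
      have "J x \<le> J (x + t *\<^sub>R h)"
        using Jx m_le[of "x + t *\<^sub>R h"] x that H by (simp add: hilbert_space_intros)
      moreover have "(norm (x + t *\<^sub>R h))\<^sup>2 = (norm x)\<^sup>2 + 2 * t * inner h x + t\<^sup>2 * (norm h)\<^sup>2"
        unfolding power2_norm_eq_inner
        by (simp add: inner_add inner_commute algebra_simps power2_eq_square)
      ultimately show ?thesis
        using x that H by (simp add: J_def add scale hilbert_space_intros algebra_simps)
    qed
    show ?thesis
    proof (rule ccontr)
      assume ne: "f h \<noteq> inner h x"
      define d where "d = inner h x - f h"
      \<comment> \<open>The test value t = - d / c would minimise the quadratic if c were the
        squared norm of h; the added 1 keeps c positive when h = 0.\<close>
      define c where "c = (norm h)\<^sup>2 + 1"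
      have "d \<noteq> 0" "0 < c" using ne by (auto simp: d_def c_def intro: add_nonneg_pos)
      have "0 \<le> (d/c)\<^sup>2 * (c - 1) / 2 - d / c * d"
        using *[of "- (d / c)"] by (simp add: d_def[symmetric] c_def)
      also have "\<dots> \<le> (d/c)\<^sup>2 * c / 2 - d / c * d"
        by (simp add: algebra_simps)
      also have "\<dots> = - (d\<^sup>2 / (2 * c))"
        using \<open>0 < c\<close> by (simp add: field_simps power2_eq_square)
      also have "\<dots> < 0" using \<open>d \<noteq> 0\<close> \<open>0 < c\<close> by simp
      finally show False by simp
    qed
  qed
  then show ?thesis using x by blast
qed

text \<open>The real version is applied to the real part of f; testing it at i h recovers the
  imaginary part, as the real part of f (i h) is minus the imaginary part of f h.\<close>

lemma riesz:
  fixes H :: "'a::complex_inner set" and f :: "'a \<Rightarrow> complex"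
  assumes H: "hilbert_space H"
    and add: "\<And>x y. x \<in> H \<Longrightarrow> y \<in> H \<Longrightarrow> f (x + y) = f x + f y"
    and scale: "\<And>a x. x \<in> H \<Longrightarrow> f (a *\<^sub>C x) = a * f x"
    and bound: "\<And>x. x \<in> H \<Longrightarrow> cmod (f x) \<le> M * norm x"
  shows "\<exists>!x. x \<in> H \<and> (\<forall>h\<in>H. f h = cinner h x)"
proof -
  have "\<exists>x\<in>H. \<forall>h\<in>H. Re (f h) = inner h x"
  proof (rule riesz_real[OF H])
    show "Re (f (r *\<^sub>R x)) = r * Re (f x)" if "x \<in> H" for r x
      using scale[OF that, of "of_real r"] by (simp add: scaleC_of_real)
    show "\<bar>Re (f x)\<bar> \<le> M * norm x" if "x \<in> H" for x
      using bound[OF that] abs_Re_le_cmod order_trans by blast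
  qed (simp add: add)
  then obtain x where x: "x \<in> H" and Re: "\<And>h. h \<in> H \<Longrightarrow> Re (f h) = Re (cinner h x)"
    by (auto simp: Re_cinner)
  have "f h = cinner h x" if "h \<in> H" for h
    using Re[OF that] Re[OF hilbert_space_scaleC[OF H that, of \<i>]] scale[OF that, of \<i>]
    by (simp add: complex_eq_iff cinner_scaleC_left)
  then show ?thesis
    using x by (auto intro: hilbert_space_eqI[OF H])
qed

lemma bops_mem: "A \<in> bops H K \<Longrightarrow> x \<in> H \<Longrightarrow> A x \<in> K"
  and bops_add: "A \<in> bops H K \<Longrightarrow> x \<in> H \<Longrightarrow> y \<in> H \<Longrightarrow> A (x + y) = A x + A y"
  and bops_scaleC: "A \<in> bops H K \<Longrightarrow> x \<in> H \<Longrightarrow> A (a *\<^sub>C x) = a *\<^sub>C A x"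
  by (auto simp: bops_def)

lemma bops_scaleR: "A \<in> bops H K \<Longrightarrow> x \<in> H \<Longrightarrow> A (r *\<^sub>R x) = r *\<^sub>R A x"
  by (metis bops_scaleC scaleC_of_real)

lemma bops_zero: "A \<in> bops H K \<Longrightarrow> hilbert_space H \<Longrightarrow> A 0 = 0"
  by (metis bops_scaleC hilbert_space_zero scaleC_zero_left)

lemma bops_diff:
  assumes "A \<in> bops H K" "hilbert_space H" "x \<in> H" "y \<in> H" shows "A (x - y) = A x - A y"
  using bops_add[OF assms(1), of "x - y" y] assms by (simp add: hilbert_space_diff)

text \<open>A strictly positive constant, unlike the one in \<open>bops\<close>, can be divided by
  and cancelled.\<close>

lemma bops_bound: "A \<in> bops H K \<Longrightarrow> \<exists>M>0. \<forall>x\<in>H. norm (A x) \<le> M * norm x"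
proof -
  assume "A \<in> bops H K"
  then obtain M where M: "\<forall>x\<in>H. norm (A x) \<le> M * norm x" by (auto simp: bops_def)
  have "norm (A x) \<le> (\<bar>M\<bar> + 1) * norm x" if "x \<in> H" for x
  proof -
    have "M * norm x \<le> (\<bar>M\<bar> + 1) * norm x" by (rule mult_right_mono) auto
    then show ?thesis using M that by fastforce
  qed
  then show ?thesis by (intro exI[of _ "\<bar>M\<bar> + 1"]) auto
qed

lemma bopsI:
  assumes "\<And>x. x \<in> H \<Longrightarrow> A x \<in> K"
    and "\<And>x y. x \<in> H \<Longrightarrow> y \<in> H \<Longrightarrow> A (x + y) = A x + A y"
    and "\<And>a x. x \<in> H \<Longrightarrow> A (a *\<^sub>C x) = a *\<^sub>C A x"
    and "\<And>x. x \<in> H \<Longrightarrow> norm (A x) \<le> M * norm x"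
  shows "A \<in> bops H K"
  unfolding bops_def using assms by blast

lemma bops_restrict:
  assumes "A \<in> bops H K" "hilbert_space L" "L \<subseteq> H" "\<And>x. x \<in> L \<Longrightarrow> A x \<in> L'"
  shows "restrict A L \<in> bops L L'"
proof -
  obtain M where "\<forall>x\<in>H. norm (A x) \<le> M * norm x" using bops_bound[OF assms(1)] by blast
  with assms show ?thesis
    by (intro bopsI[where M = M]) (auto simp: hilbert_space_intros bops_add bops_scaleC subset_iff)
qed

text \<open>Gives meaning to the description in \<open>adj\<close>: sending h to
  \<open>cinner (A h) y\<close> is bounded and linear, so Riesz represents it.\<close>

lemma adj_ex1:
  assumes "hilbert_space H" "A \<in> bops H K"
  shows "\<exists>!x. x \<in> H \<and> (\<forall>h\<in>H. cinner (A h) y = cinner h x)"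
proof -
  obtain M where M: "0 < M" "\<forall>x\<in>H. norm (A x) \<le> M * norm x" using bops_bound[OF assms(2)] by blast
  show ?thesis
  proof (rule riesz[OF assms(1), where M = "M * norm y"])
    fix x assume "x \<in> H"
    have "cmod (cinner (A x) y) \<le> norm (A x) * norm y" by (rule norm_cinner_le)
    also have "\<dots> \<le> (M * norm x) * norm y" using M \<open>x \<in> H\<close> by (intro mult_right_mono) auto
    finally show "cmod (cinner (A x) y) \<le> M * norm y * norm x" by (simp add: mult_ac)
  qed (use assms in \<open>simp_all add: bops_add bops_scaleC cinner_add_left cinner_scaleC_left\<close>)
qed

lemma
  assumes "hilbert_space H" "A \<in> bops H K" "y \<in> K"
  shows adj_mem: "adj H K A y \<in> H"
    and cinner_adj_right: "\<And>h. h \<in> H \<Longrightarrow> cinner h (adj H K A y) = cinner (A h) y"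
  using theI'[OF adj_ex1[OF assms(1,2), of y]] assms(3) by (auto simp: adj_def)

lemma cinner_adj_left:
  assumes "hilbert_space H" "A \<in> bops H K" "y \<in> K" "h \<in> H"
  shows "cinner (adj H K A y) h = cinner y (A h)"
  using cinner_adj_right[OF assms] by (metis cinner_commute)

lemma adj_eqI:
  assumes "hilbert_space H" "A \<in> bops H K" "y \<in> K" "x \<in> H"
    "\<And>h. h \<in> H \<Longrightarrow> cinner (A h) y = cinner h x"
  shows "adj H K A y = x"
  by (rule hilbert_space_eqI[OF assms(1)]) (use assms in \<open>simp_all add: adj_mem cinner_adj_right\<close>)

lemma adj_bops:
  assumes H: "hilbert_space H" and K: "hilbert_space K" and A: "A \<in> bops H K"
  shows "adj H K A \<in> bops K H"
proof -
  obtain M where M: "0 < M" "\<forall>x\<in>H. norm (A x) \<le> M * norm x" using bops_bound[OF A] by blast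
  show ?thesis
  proof (rule bopsI[where M = M])
    fix x y :: 'b and a assume x: "x \<in> K"
    show mem: "adj H K A x \<in> H" using x by (simp add: adj_mem H A)
    show "adj H K A (a *\<^sub>C x) = a *\<^sub>C adj H K A x"
      using x mem by (intro adj_eqI[OF H A]) (auto simp: hilbert_space_intros H K
          cinner_scaleC_right cinner_adj_right[OF H A])
    show "adj H K A (x + y) = adj H K A x + adj H K A y" if "y \<in> K"
      using x mem that by (intro adj_eqI[OF H A]) (auto simp: hilbert_space_intros H K
          cinner_add_right cinner_adj_right[OF H A] adj_mem[OF H A])
    \<comment> \<open>Rewriting the squared norm of z as an inner product with A z leaves one factor
      \<open>norm z\<close> on the right, which cancels.\<close>
    define z where "z = adj H K A x"
    have "(norm z)\<^sup>2 = cmod (cinner z z)" by (simp add: cinner_self norm_power)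
    also have "\<dots> = cmod (cinner (A z) x)"
      using cinner_adj_right[OF H A x mem] by (simp add: z_def)
    also have "\<dots> \<le> norm (A z) * norm x" by (rule norm_cinner_le)
    also have "\<dots> \<le> (M * norm z) * norm x"
      using M mem by (intro mult_right_mono) (auto simp: z_def)
    finally have "norm z * norm z \<le> norm z * (M * norm x)"
      by (simp add: power2_eq_square mult_ac)
    then have "norm z \<le> M * norm x"
      using M(1) by (cases "z = 0") (auto simp: mult_le_cancel_left)
    then show "norm (adj H K A x) \<le> M * norm x" by (simp add: z_def)
  qed
qed

section \<open>Orthogonal projections and complements\<close>

text \<open>The projection of x is the Riesz representer on H of the functional sending h to
  \<open>cinner h x\<close>.\<close>

lemma orth_proj_ex1:
  assumes "hilbert_space H"
  shows "\<exists>!p. p \<in> H \<and> (\<forall>h\<in>H. cinner (x - p) h = 0)"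
proof -
  have eq: "cinner (x - p) h = 0 \<longleftrightarrow> cinner h x = cinner h p" for p h
    using cinner_eq_0_sym[of "x - p" h] cinner_eq_0_sym[of h "x - p"]
    by (auto simp: cinner_diff_right)
  have "\<exists>!p. p \<in> H \<and> (\<forall>h\<in>H. cinner h x = cinner h p)"
    by (rule riesz[OF assms, where M = "norm x"])
      (use norm_cinner_le in \<open>auto simp: cinner_add_left cinner_scaleC_left mult.commute\<close>)
  then show ?thesis by (simp only: eq)
qed

lemma
  assumes "hilbert_space H" "x \<in> K"
  shows orth_proj_mem: "orth_proj K H x \<in> H"
    and orth_proj_orth: "\<And>h. h \<in> H \<Longrightarrow> cinner (x - orth_proj K H x) h = 0"
  using theI'[OF orth_proj_ex1[OF assms(1), of x]] assms(2) by (auto simp: orth_proj_def)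

lemma orth_proj_eqI:
  assumes "hilbert_space H" "x \<in> K" "p \<in> H" "\<And>h. h \<in> H \<Longrightarrow> cinner (x - p) h = 0"
  shows "orth_proj K H x = p"
  using theI'[OF orth_proj_ex1[OF assms(1), of x]] orth_proj_ex1[OF assms(1), of x] assms
  by (auto simp: orth_proj_def)

text \<open>The set bound by the \<open>let\<close> in \<open>reduces\<close>, named so that
  complements can be iterated.\<close>

definition ocomp :: "'a::complex_inner set \<Rightarrow> 'a set \<Rightarrow> 'a set" where
  "ocomp H L = {x \<in> H. \<forall>y\<in>L. cinner x y = 0}"

lemma closed_cinner_eq_0: "closed {x :: 'a::complex_inner. cinner x y = 0}"
  by (intro closed_Collect_eq continuous_intros
      bounded_linear.continuous_on[OF bounded_bilinear.bounded_linear_left[OF bounded_bilinear_cinner]])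

lemma hilbert_space_closed_subspace:
  assumes "hilbert_space H" "closed L" "L \<subseteq> H" "0 \<in> L"
    "\<And>x y. x \<in> L \<Longrightarrow> y \<in> L \<Longrightarrow> x + y \<in> L" "\<And>a x. x \<in> L \<Longrightarrow> a *\<^sub>C x \<in> L"
  shows "hilbert_space L"
proof -
  have "complete (L \<inter> H)"
    using assms complete_Int_closed hilbert_space_complete by (metis Int_commute)
  then show ?thesis using assms by (simp add: hilbert_space_def Int_absorb2)
qed

lemma hilbert_space_ocomp: "hilbert_space H \<Longrightarrow> hilbert_space (ocomp H L)"
proof (rule hilbert_space_closed_subspace)
  assume "hilbert_space H"
  have "ocomp H L = H \<inter> (\<Inter>y\<in>L. {x. cinner x y = 0})" by (auto simp: ocomp_def)
  then show "closed (ocomp H L)"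
    using hilbert_space_closed[OF \<open>hilbert_space H\<close>] closed_cinner_eq_0
    by (auto intro!: closed_Int closed_INT)
qed (auto simp: ocomp_def hilbert_space_intros cinner_add_left cinner_scaleC_left)

lemma orth_decomp_ocomp:
  assumes "hilbert_space H" "hilbert_space L" "L \<subseteq> H"
  shows "orth_decomp H L (ocomp H L)"
proof -
  have "\<exists>y z. x = y + z \<and> y \<in> L \<and> z \<in> ocomp H L" if "x \<in> H" for x
  proof (intro exI conjI)
    show "x = orth_proj H L x + (x - orth_proj H L x)" by simp
    show "orth_proj H L x \<in> L" using orth_proj_mem[OF assms(2) that] .
    then show "x - orth_proj H L x \<in> ocomp H L"
      using orth_proj_orth[OF assms(2) that] that assms
      by (auto simp: ocomp_def intro!: hilbert_space_diff)
  qed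
  then show ?thesis
    using assms hilbert_space_ocomp[OF assms(1), of L] cinner_eq_0_sym
    by (force simp: orth_decomp_def ocomp_def hilbert_space_add subset_iff)
qed

lemma orth_decomp_sym: "orth_decomp H L M \<Longrightarrow> orth_decomp H M L"
  using cinner_eq_0_sym by (auto simp: orth_decomp_def) (metis add.commute)+

text \<open>Lets facts about \<open>ocomp\<close>, and thereby about \<open>reduces\<close>, carry
  over to decompositions given in any form.\<close>

lemma orth_decomp_ocomp_eq:
  assumes "orth_decomp H L M"
  shows "M = ocomp H L"
proof -
  have L: "hilbert_space L" and M: "hilbert_space M"
    and ort: "\<And>x y. x \<in> L \<Longrightarrow> y \<in> M \<Longrightarrow> cinner x y = 0"
    and H: "H = {x + y | x y. x \<in> L \<and> y \<in> M}"
    using assms by (auto simp: orth_decomp_def)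
  show ?thesis
  proof
    have "0 + y \<in> H" if "y \<in> M" for y unfolding H using hilbert_space_zero[OF L] that by blast
    then show "M \<subseteq> ocomp H L" using cinner_eq_0_sym[OF ort] by (auto simp: ocomp_def)
    show "ocomp H L \<subseteq> M"
    proof
      fix z assume z: "z \<in> ocomp H L"
      then obtain x y where xy: "z = x + y" "x \<in> L" "y \<in> M" by (auto simp: ocomp_def H)
      have "cinner z x = 0" using z xy by (auto simp: ocomp_def)
      then have "cinner x x = 0" using xy cinner_eq_0_sym[OF ort[of x y]] by (simp add: cinner_add_left)
      then show "z \<in> M" using xy by simp
    qed
  qed
qed

lemma reduces_iff:
  "reduces K A L \<longleftrightarrow> hilbert_space L \<and> L \<subseteq> K \<and> A ` L \<subseteq> L \<and> A ` ocomp K L \<subseteq> ocomp K L"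
  by (simp add: reduces_def ocomp_def Let_def)

text \<open>A preserves the complement of L exactly when its adjoint preserves L; one direction uses
  that taking the complement twice returns L. In this form kernels and intersections are easy to
  treat.\<close>

lemma reduces_iff_adj:
  assumes "hilbert_space K" "A \<in> bops K K"
  shows "reduces K A L \<longleftrightarrow> hilbert_space L \<and> L \<subseteq> K \<and> A ` L \<subseteq> L \<and> adj K K A ` L \<subseteq> L"
proof -
  note cadj = cinner_adj_right[OF assms] cinner_adj_left[OF assms]
  have "A ` ocomp K L \<subseteq> ocomp K L \<longleftrightarrow> adj K K A ` L \<subseteq> L" if L: "hilbert_space L" "L \<subseteq> K"
  proof
    assume *: "A ` ocomp K L \<subseteq> ocomp K L"
    have "L = ocomp K (ocomp K L)"
      by (rule orth_decomp_ocomp_eq[OF orth_decomp_sym[OF orth_decomp_ocomp[OF assms(1) L]]])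
    moreover have "adj K K A x \<in> ocomp K (ocomp K L)" if "x \<in> L" for x
    proof -
      have "cinner (adj K K A x) y = 0" if "y \<in> ocomp K L" for y
      proof -
        have "A y \<in> ocomp K L" "y \<in> K" using * that by (auto simp: ocomp_def)
        then show ?thesis
          using \<open>x \<in> L\<close> L cinner_eq_0_sym by (subst cadj) (auto simp: ocomp_def)
      qed
      then show ?thesis using adj_mem[OF assms] that L by (auto simp: ocomp_def)
    qed
    ultimately show "adj K K A ` L \<subseteq> L" by auto
  next
    assume "adj K K A ` L \<subseteq> L"
    then show "A ` ocomp K L \<subseteq> ocomp K L"
      using L bops_mem[OF assms(2)] by (force simp: ocomp_def cadj(1)[symmetric])
  qed
  then show ?thesis by (auto simp: reduces_iff)
qed

section \<open>Square roots of positive operators\<close>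

lemma positive_op_bops: "positive_op H A \<Longrightarrow> A \<in> bops H H"
  and positive_op_nonneg: "positive_op H A \<Longrightarrow> x \<in> H \<Longrightarrow> 0 \<le> Re (cinner (A x) x)"
  by (auto simp: positive_op_def)

text \<open>\<open>positive_op\<close> only asks for a real nonnegative quadratic form. Polarisation
  recovers symmetry: x + y settles the imaginary parts and x + i y the real parts.\<close>

lemma positive_op_hermitian:
  assumes H: "hilbert_space H" and A: "positive_op H A" and x: "x \<in> H" and y: "y \<in> H"
  shows "cinner (A x) y = cinner x (A y)"
proof -
  note bops = positive_op_bops[OF A]
  have real: "Im (cinner (A z) z) = 0" if "z \<in> H" for z
    using A that by (auto simp: positive_op_def complex_is_Real_iff)
  have "Im (cinner (A x) y) + Im (cinner (A y) x) = 0"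
    using real[of "x + y"] real[OF x] real[OF y] H x y
    by (simp add: hilbert_space_add bops_add[OF bops] cinner_add_left cinner_add_right)
  moreover have "Re (cinner (A y) x) - Re (cinner (A x) y) = 0"
    using real[of "x + \<i> *\<^sub>C y"] real[OF x] real[OF y] H x y
    by (simp add: hilbert_space_intros bops_add[OF bops] bops_scaleC[OF bops] cinner_add_left
        cinner_add_right cinner_scaleC_left cinner_scaleC_right)
  ultimately have "cinner (A x) y = cnj (cinner (A y) x)"
    by (simp add: complex_eq_iff)
  then show ?thesis by (metis cinner_commute)
qed

lemma positive_opI:
  assumes "A \<in> bops H H" "\<And>x. x \<in> H \<Longrightarrow> cinner (A x) x = cinner x (A x)"
    "\<And>x. x \<in> H \<Longrightarrow> 0 \<le> Re (cinner (A x) x)"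
  shows "positive_op H A"
proof -
  have "cinner (A x) x \<in> \<real>" if "x \<in> H" for x
    using assms(2)[OF that] by (metis Reals_cnj_iff cinner_commute)
  then show ?thesis using assms by (simp add: positive_op_def)
qed

lemma positive_op_restrict:
  assumes "positive_op H A" "hilbert_space L" "L \<subseteq> H" "\<And>x. x \<in> L \<Longrightarrow> A x \<in> L"
  shows "positive_op L (restrict A L)"
  using assms bops_restrict[OF positive_op_bops[OF assms(1)] assms(2-4)]
  by (auto simp: positive_op_def subset_iff)

text \<open>Expand the nonnegative form of A at x - A x / M. The quadratic term is at most 1 / M
  times the squared norm of A x, so it is absorbed by half of the mixed term.\<close>

lemma positive_op_norm_sq_le:
  assumes H: "hilbert_space H" and A: "positive_op H A"
    and M: "0 < M" "\<And>x. x \<in> H \<Longrightarrow> norm (A x) \<le> M * norm x" and x: "x \<in> H"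
  shows "(norm (A x))\<^sup>2 \<le> M * Re (cinner (A x) x)"
proof -
  note bops = positive_op_bops[OF A]
  have Ax: "A x \<in> H" using bops x by (rule bops_mem)
  define y where "y = x - (1/M) *\<^sub>R A x"
  have AA: "Re (cinner (A (A x)) (A x)) \<le> M * (norm (A x))\<^sup>2"
  proof -
    have "Re (cinner (A (A x)) (A x)) \<le> norm (A (A x)) * norm (A x)"
      by (metis Re_cinner norm_cauchy_schwarz)
    also have "\<dots> \<le> (M * norm (A x)) * norm (A x)"
      using M Ax by (intro mult_right_mono) auto
    finally show ?thesis by (simp add: power2_eq_square)
  qed
  have "y \<in> H" using H x Ax by (simp add: y_def hilbert_space_intros)
  then have "0 \<le> Re (cinner (A y) y)" using A by (simp add: positive_op_nonneg)
  also have "A y = A x - (1/M) *\<^sub>R A (A x)"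
    using H x Ax by (simp add: y_def bops_diff[OF bops] bops_scaleR[OF bops] hilbert_space_intros)
  also have "Re (cinner (A x - (1/M) *\<^sub>R A (A x)) y) =
      Re (cinner (A x) x) - 2 / M * (norm (A x))\<^sup>2 + Re (cinner (A (A x)) (A x)) / M\<^sup>2"
    using positive_op_hermitian[OF H A Ax x]
    by (simp add: y_def cinner_diff_left cinner_diff_right cinner_scaleR_left cinner_scaleR_right
        cinner_self power2_eq_square)
      (use M(1) in \<open>simp add: field_simps\<close>)
  also have "\<dots> \<le> Re (cinner (A x) x) - 2 / M * (norm (A x))\<^sup>2 + M * (norm (A x))\<^sup>2 / M\<^sup>2"
    using AA by (intro add_left_mono divide_right_mono) auto
  also have "\<dots> = (M * Re (cinner (A x) x) - (norm (A x))\<^sup>2) / M"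
    using M(1) by (simp add: field_simps power2_eq_square)
  finally show ?thesis using M(1) by (simp add: zero_le_divide_iff)
qed

lemma positive_op_eq_0:
  assumes "hilbert_space H" "positive_op H A" "x \<in> H" "Re (cinner (A x) x) = 0"
  shows "A x = 0"
proof -
  obtain M where "0 < M" "\<And>x. x \<in> H \<Longrightarrow> norm (A x) \<le> M * norm x"
    using bops_bound[OF positive_op_bops[OF assms(2)]] by blast
  from positive_op_norm_sq_le[OF assms(1,2) this assms(3)] show ?thesis using assms(4) by simp
qed

text \<open>
  The square root of \<open>A\<close> with \<open>0 \<le> A \<le> 1\<close> is \<open>1 - Y\<close>, where \<open>Y\<close> is the limit of the iteration below
  with \<open>B = 1 - A\<close>. The iteration for \<open>B = 1\<close> on the real line majorises it: the distance of two
  iterates is at most that of the corresponding real ones, so convergence is in norm.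
\<close>

primrec sqrt_iter :: "('a \<Rightarrow> 'a) \<Rightarrow> nat \<Rightarrow> 'a \<Rightarrow> 'a::real_vector" where
  "sqrt_iter B 0 x = 0"
| "sqrt_iter B (Suc n) x = (1/2) *\<^sub>R (B x + sqrt_iter B n (sqrt_iter B n x))"

primrec sqrt_major :: "nat \<Rightarrow> real" where
  "sqrt_major 0 = 0"
| "sqrt_major (Suc n) = (1 + (sqrt_major n)\<^sup>2) / 2"

lemma sqrt_major_bounds: "0 \<le> sqrt_major n \<and> sqrt_major n \<le> 1"
  by (induction n) (auto simp: power_le_one)

lemma sqrt_major_mono: "mono sqrt_major"
proof (rule incseq_SucI)
  fix n show "sqrt_major n \<le> sqrt_major (Suc n)"
    using zero_le_power2[of "1 - sqrt_major n"] by (simp add: power2_eq_square algebra_simps)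
qed

text \<open>The limit is a fixed point of the recursion, and the fixed-point equation has only the
  double root 1.\<close>

lemma sqrt_major_tendsto: "sqrt_major \<longlonglongrightarrow> 1"
proof -
  obtain l where l: "sqrt_major \<longlonglongrightarrow> l"
    using incseq_convergent[OF sqrt_major_mono, of 1] sqrt_major_bounds by metis
  have "(\<lambda>n. sqrt_major (Suc n)) \<longlonglongrightarrow> (1 + l\<^sup>2) / 2"
    unfolding sqrt_major.simps by (intro tendsto_intros l) simp
  then have "l = (1 + l\<^sup>2) / 2"
    using LIMSEQ_unique LIMSEQ_Suc[OF l] by blast
  then have "(l - 1)\<^sup>2 = 0" by (simp add: power2_eq_square algebra_simps)
  then show ?thesis using l by simp
qed

context
  fixes H :: "'a::complex_inner set" and B :: "'a \<Rightarrow> 'a"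
  assumes H: "hilbert_space H" and B: "B \<in> bops H H"
    and B_le: "\<And>x. x \<in> H \<Longrightarrow> norm (B x) \<le> norm x"
begin

lemma sqrt_iter_mem: "x \<in> H \<Longrightarrow> sqrt_iter B n x \<in> H"
  by (induction n arbitrary: x) (auto simp: hilbert_space_intros H bops_mem[OF B])

lemma sqrt_iter_norm: "x \<in> H \<Longrightarrow> norm (sqrt_iter B n x) \<le> sqrt_major n * norm x"
proof (induction n arbitrary: x)
  case (Suc n)
  let ?Y = "sqrt_iter B n" and ?q = "sqrt_major n"
  have "norm (?Y (?Y x)) \<le> ?q * norm (?Y x)" using Suc sqrt_iter_mem by blast
  also have "\<dots> \<le> ?q * (?q * norm x)"
    using Suc sqrt_major_bounds by (intro mult_left_mono) auto
  finally have "norm (B x + ?Y (?Y x)) \<le> norm x + ?q * (?q * norm x)"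
    using B_le[OF Suc.prems] norm_triangle_mono by blast
  then have "norm (sqrt_iter B (Suc n) x) \<le> (norm x + ?q * (?q * norm x)) / 2"
    unfolding sqrt_iter.simps norm_scaleR by simp
  then show ?case by (simp add: power2_eq_square field_simps)
qed simp

lemma sqrt_iter_bops: "sqrt_iter B n \<in> bops H H"
proof (rule bopsI[OF sqrt_iter_mem _ _ sqrt_iter_norm])
  show "x \<in> H \<Longrightarrow> y \<in> H \<Longrightarrow> sqrt_iter B n (x + y) = sqrt_iter B n x + sqrt_iter B n y" for x y
  proof (induction n arbitrary: x y)
    case (Suc n)
    then show ?case
      using bops_add[OF B] sqrt_iter_mem by (simp add: algebra_simps)
  qed simp
  show "x \<in> H \<Longrightarrow> sqrt_iter B n (a *\<^sub>C x) = a *\<^sub>C sqrt_iter B n x" for a x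
  proof (induction n arbitrary: x)
    case (Suc n)
    then have "sqrt_iter B (Suc n) (a *\<^sub>C x) =
        (1/2) *\<^sub>R (a *\<^sub>C (B x + sqrt_iter B n (sqrt_iter B n x)))"
      using bops_scaleC[OF B] sqrt_iter_mem by (simp add: scaleC_add_right)
    also have "\<dots> = a *\<^sub>C sqrt_iter B (Suc n) x"
      by (simp add: scaleR_scaleC)
    finally show ?case .
  qed simp
qed

lemma sqrt_iter_hermitian:
  assumes "\<And>x y. x \<in> H \<Longrightarrow> y \<in> H \<Longrightarrow> cinner (B x) y = cinner x (B y)"
  shows "x \<in> H \<Longrightarrow> y \<in> H \<Longrightarrow> cinner (sqrt_iter B n x) y = cinner x (sqrt_iter B n y)"
  by (induction n arbitrary: x y)
    (simp_all add: cinner_scaleR_left cinner_scaleR_right cinner_add_left cinner_add_right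
      sqrt_iter_mem assms)

lemma sqrt_iter_commute:
  assumes C: "C \<in> bops H H" and CB: "\<And>x. x \<in> H \<Longrightarrow> C (B x) = B (C x)"
  shows "x \<in> H \<Longrightarrow> C (sqrt_iter B n x) = sqrt_iter B n (C x)"
  by (induction n arbitrary: x)
    (simp_all add: bops_zero[OF C H] bops_scaleR[OF C] bops_add[OF C] bops_mem[OF B]
      bops_mem[OF C] sqrt_iter_mem hilbert_space_add[OF H] CB)

text \<open>Write Y and Z for the iterates and q and r for their majorants. Then Y Y - Z Z = Y (Y -
  Z) + (Y - Z) Z, and the two bounds add up to (q - r) (q + r), which is twice the difference of the
  next two majorants.\<close>

lemma sqrt_iter_dist:
  "n \<le> m \<Longrightarrow> x \<in> H \<Longrightarrow>
    norm (sqrt_iter B m x - sqrt_iter B n x) \<le> (sqrt_major m - sqrt_major n) * norm x"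
proof (induction n arbitrary: m x)
  case 0
  then show ?case using sqrt_iter_norm by simp
next
  case (Suc n)
  then obtain k where k: "m = Suc k" "n \<le> k" by (cases m) auto
  let ?Y = "sqrt_iter B k" and ?Z = "sqrt_iter B n" and ?q = "sqrt_major k" and ?r = "sqrt_major n"
  have q: "0 \<le> ?q" "0 \<le> ?r" "?r \<le> ?q"
    using sqrt_major_bounds monoD[OF sqrt_major_mono k(2)] by auto
  have YZ: "?Y x \<in> H" "?Z x \<in> H" using Suc.prems sqrt_iter_mem by auto
  have "norm (?Y (?Y x - ?Z x)) \<le> ?q * norm (?Y x - ?Z x)"
    using sqrt_iter_norm YZ H hilbert_space_diff by blast
  also have "\<dots> \<le> ?q * ((?q - ?r) * norm x)"
    using Suc.IH[OF k(2) Suc.prems(2)] q by (intro mult_left_mono)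
  finally have 1: "norm (?Y (?Y x - ?Z x)) \<le> ?q * ((?q - ?r) * norm x)" .
  have "norm (?Y (?Z x) - ?Z (?Z x)) \<le> (?q - ?r) * norm (?Z x)"
    using Suc.IH[OF k(2) YZ(2)] .
  also have "\<dots> \<le> (?q - ?r) * (?r * norm x)"
    using sqrt_iter_norm[OF Suc.prems(2)] q by (intro mult_left_mono) auto
  finally have 2: "norm (?Y (?Z x) - ?Z (?Z x)) \<le> (?q - ?r) * (?r * norm x)" .
  have "sqrt_iter B m x - sqrt_iter B (Suc n) x =
      (1/2) *\<^sub>R (?Y (?Y x - ?Z x) + (?Y (?Z x) - ?Z (?Z x)))"
    using bops_diff[OF sqrt_iter_bops H YZ] by (simp add: k algebra_simps)
  then have "norm (sqrt_iter B m x - sqrt_iter B (Suc n) x) \<le>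
      (?q * ((?q - ?r) * norm x) + (?q - ?r) * (?r * norm x)) / 2"
    using norm_triangle_mono[OF 1 2] by simp
  also have "\<dots> = (sqrt_major m - sqrt_major (Suc n)) * norm x"
    by (simp add: k power2_eq_square field_simps)
  finally show ?case .
qed

lemma sqrt_iter_tendsto:
  assumes x: "x \<in> H"
  shows "\<exists>y\<in>H. (\<lambda>n. sqrt_iter B n x) \<longlonglongrightarrow> y"
proof -
  have "Cauchy (\<lambda>n. sqrt_iter B n x)"
  proof (rule metric_CauchyI)
    fix e :: real assume "0 < e"
    have "(\<lambda>n. (1 - sqrt_major n) * norm x) \<longlonglongrightarrow> (1 - 1) * norm x"
      by (intro tendsto_intros sqrt_major_tendsto)
    then have "\<forall>\<^sub>F n in sequentially. (1 - sqrt_major n) * norm x < e"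
      using \<open>0 < e\<close> by (auto dest: order_tendstoD(2))
    then obtain n0 where n0: "\<And>n. n0 \<le> n \<Longrightarrow> (1 - sqrt_major n) * norm x < e"
      by (auto simp: eventually_sequentially)
    have "norm (sqrt_iter B m x - sqrt_iter B n x) < e" if "n0 \<le> n" "n \<le> m" for m n
    proof -
      have "(sqrt_major m - sqrt_major n) * norm x \<le> (1 - sqrt_major n) * norm x"
        using sqrt_major_bounds by (intro mult_right_mono) auto
      then show ?thesis
        using sqrt_iter_dist[OF that(2) x] n0[OF that(1)] by linarith
    qed
    then have "dist (sqrt_iter B m x) (sqrt_iter B n x) < e" if "n0 \<le> n" "n0 \<le> m" for m n
      using that by (metis dist_commute dist_norm nat_le_linear)
    then show "\<exists>n0. \<forall>m\<ge>n0. \<forall>n\<ge>n0. dist (sqrt_iter B m x) (sqrt_iter B n x) < e"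
      by blast
  qed
  then show ?thesis
    using completeE[OF hilbert_space_complete[OF H], of "\<lambda>n. sqrt_iter B n x"] sqrt_iter_mem[OF x]
    by blast
qed

lemma ex_sqrt_iter_limit:
  "\<exists>Y\<in>bops H H. (\<forall>x\<in>H. (\<lambda>n. sqrt_iter B n x) \<longlonglongrightarrow> Y x) \<and> (\<forall>x\<in>H. norm (Y x) \<le> norm x) \<and>
     (\<forall>x\<in>H. 2 *\<^sub>R Y x = B x + Y (Y x))"
proof -
  define Y where "Y x = lim (\<lambda>n. sqrt_iter B n x)" for x
  have lim: "(\<lambda>n. sqrt_iter B n x) \<longlonglongrightarrow> Y x" and mem: "Y x \<in> H" if "x \<in> H" for x
    using sqrt_iter_tendsto[OF that] limI unfolding Y_def by blast+
  have norm: "norm (Y x) \<le> norm x" if "x \<in> H" for x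
  proof (rule LIMSEQ_le_const2[OF tendsto_norm[OF lim[OF that]]])
    have "sqrt_major n * norm x \<le> 1 * norm x" for n
      using sqrt_major_bounds by (intro mult_right_mono) auto
    then have "norm (sqrt_iter B n x) \<le> norm x" for n
      using sqrt_iter_norm[OF that, of n] by (metis mult_1 order_trans)
    then show "\<exists>N. \<forall>n\<ge>N. norm (sqrt_iter B n x) \<le> norm x" by blast
  qed
  have bops: "Y \<in> bops H H"
  proof (rule bopsI[where M = 1])
    fix x y a assume x: "x \<in> H"
    show "Y (a *\<^sub>C x) = a *\<^sub>C Y x"
    proof (rule LIMSEQ_unique[OF lim])
      show "(\<lambda>n. sqrt_iter B n (a *\<^sub>C x)) \<longlonglongrightarrow> a *\<^sub>C Y x"
        unfolding bops_scaleC[OF sqrt_iter_bops x]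
        by (rule bounded_linear.tendsto[OF bounded_linear_scaleC lim[OF x]])
    qed (simp add: H hilbert_space_scaleC x)
    show "Y (x + y) = Y x + Y y" if "y \<in> H"
    proof (rule LIMSEQ_unique[OF lim])
      show "(\<lambda>n. sqrt_iter B n (x + y)) \<longlonglongrightarrow> Y x + Y y"
        unfolding bops_add[OF sqrt_iter_bops x that] by (intro tendsto_intros lim x that)
    qed (simp add: H hilbert_space_add x that)
  qed (use mem norm in auto)
  have "2 *\<^sub>R Y x = B x + Y (Y x)" if x: "x \<in> H" for x
  proof (rule LIMSEQ_unique)
    show "(\<lambda>n. 2 *\<^sub>R sqrt_iter B (Suc n) x) \<longlonglongrightarrow> 2 *\<^sub>R Y x"
      by (intro tendsto_intros LIMSEQ_Suc lim x)
    \<comment> \<open>In the twice applied iterate both the operator and its argument vary with n.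
      All iterates are contractions, so replacing the inner one by Y x costs an error that
      vanishes.\<close>
    have "(\<lambda>n. sqrt_iter B n (sqrt_iter B n x - Y x)) \<longlonglongrightarrow> 0"
    proof (rule Lim_null_comparison)
      show "(\<lambda>n. norm (sqrt_iter B n x - Y x)) \<longlonglongrightarrow> 0"
        using lim[OF x] LIM_zero tendsto_norm_zero by blast
      have "norm (sqrt_iter B n (sqrt_iter B n x - Y x)) \<le> norm (sqrt_iter B n x - Y x)" for n
      proof -
        have "sqrt_iter B n x - Y x \<in> H" by (simp add: H hilbert_space_diff mem sqrt_iter_mem x)
        then have "norm (sqrt_iter B n (sqrt_iter B n x - Y x)) \<le>
            sqrt_major n * norm (sqrt_iter B n x - Y x)" by (rule sqrt_iter_norm)
        also have "\<dots> \<le> 1 * norm (sqrt_iter B n x - Y x)"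
          using sqrt_major_bounds by (intro mult_right_mono) auto
        finally show ?thesis by simp
      qed
      then show "\<forall>\<^sub>F n in sequentially.
          norm (sqrt_iter B n (sqrt_iter B n x - Y x)) \<le> norm (sqrt_iter B n x - Y x)" by simp
    qed
    then have "(\<lambda>n. B x + (sqrt_iter B n (sqrt_iter B n x - Y x) + sqrt_iter B n (Y x)))
        \<longlonglongrightarrow> B x + (0 + Y (Y x))"
      by (intro tendsto_intros lim mem x)
    then show "(\<lambda>n. 2 *\<^sub>R sqrt_iter B (Suc n) x) \<longlonglongrightarrow> B x + Y (Y x)"
      using bops_diff[OF sqrt_iter_bops H sqrt_iter_mem[OF x] mem[OF x]] by simp
  qed
  then show ?thesis using bops lim norm by blast
qed

end

text \<open>From 2 Y = B + Y Y with B = 1 - A, the operator R = 1 - Y squares to 1 - B = A. The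
  iterates are polynomials in B, so a bounded C commuting with A commutes with them and, by
  continuity, with R.\<close>

lemma ex_sqrt_contraction:
  assumes H: "hilbert_space H" and A: "positive_op H A"
    and A_le: "\<And>x. x \<in> H \<Longrightarrow> norm (A x) \<le> norm x"
  shows "\<exists>R. positive_op H R \<and> (\<forall>x\<in>H. R (R x) = A x) \<and>
    (\<forall>C\<in>bops H H. (\<forall>x\<in>H. C (A x) = A (C x)) \<longrightarrow> (\<forall>x\<in>H. C (R x) = R (C x)))"
proof -
  note A_bops = positive_op_bops[OF A]
  define B where "B x = x - A x" for x
  have B_le: "norm (B x) \<le> norm x" if "x \<in> H" for x
  proof -
    \<comment> \<open>The squared norm of B x differs from that of x by the squared norm of A x
      minus twice the form of A at x. This is at most 0 by \<open>positive_op_norm_sq_le\<close> at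
      M = 1 and positivity.\<close>
    have "(norm (A x))\<^sup>2 \<le> 2 * Re (cinner (A x) x)"
      using positive_op_norm_sq_le[OF H A, of 1, OF _ _ that] A_le positive_op_nonneg[OF A that]
      by simp
    then have "(norm (B x))\<^sup>2 \<le> (norm x)\<^sup>2"
      by (simp add: B_def power2_norm_eq_inner inner_diff inner_commute Re_cinner)
    then show ?thesis by (rule power2_le_imp_le) simp
  qed
  have B: "B \<in> bops H H"
    using B_le by (intro bopsI[where M = 1])
      (auto simp: B_def H hilbert_space_intros bops_mem[OF A_bops] bops_add[OF A_bops]
        bops_scaleC[OF A_bops] scaleC_diff_right)
  obtain Y where Y: "Y \<in> bops H H" and lim: "\<And>x. x \<in> H \<Longrightarrow> (\<lambda>n. sqrt_iter B n x) \<longlonglongrightarrow> Y x"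
    and Y_le: "\<And>x. x \<in> H \<Longrightarrow> norm (Y x) \<le> norm x"
    and Y_eq: "\<And>x. x \<in> H \<Longrightarrow> 2 *\<^sub>R Y x = B x + Y (Y x)"
    using ex_sqrt_iter_limit[OF H B B_le] by blast
  have Y_herm: "cinner (Y x) y = cinner x (Y y)" if "x \<in> H" "y \<in> H" for x y
  proof (rule LIMSEQ_unique)
    show "(\<lambda>n. cinner (sqrt_iter B n x) y) \<longlonglongrightarrow> cinner (Y x) y"
      by (intro tendsto_cinner lim that tendsto_const)
    have "cinner (B u) v = cinner u (B v)" if "u \<in> H" "v \<in> H" for u v
      using positive_op_hermitian[OF H A that] by (simp add: B_def cinner_diff_left cinner_diff_right)
    then show "(\<lambda>n. cinner (sqrt_iter B n x) y) \<longlonglongrightarrow> cinner x (Y y)"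
      by (subst sqrt_iter_hermitian[OF H B B_le]) (auto intro!: tendsto_cinner lim that)
  qed
  define R where "R x = x - Y x" for x
  have R: "R \<in> bops H H"
  proof (rule bopsI[where M = 2])
    show "norm (R x) \<le> 2 * norm x" if "x \<in> H" for x
      using norm_triangle_ineq4[of x "Y x"] Y_le[OF that] by (simp add: R_def)
  qed (auto simp: R_def H hilbert_space_intros bops_mem[OF Y] bops_add[OF Y]
        bops_scaleC[OF Y] scaleC_diff_right)
  have "positive_op H R"
  proof (rule positive_opI[OF R])
    fix x assume x: "x \<in> H"
    show "cinner (R x) x = cinner x (R x)"
      using Y_herm[OF x x] by (simp add: R_def cinner_diff_left cinner_diff_right)
    have "inner (Y x) x \<le> norm (Y x) * norm x" by (rule norm_cauchy_schwarz)
    also have "\<dots> \<le> norm x * norm x" using Y_le[OF x] by (intro mult_right_mono) auto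
    finally show "0 \<le> Re (cinner (R x) x)"
      by (simp add: R_def Re_cinner inner_diff_left dot_square_norm power2_eq_square)
  qed
  moreover have "R (R x) = A x" if x: "x \<in> H" for x
    using Y_eq[OF x] by (simp add: R_def B_def bops_diff[OF Y H x bops_mem[OF Y x]] scaleR_2
        algebra_simps)
  moreover have "C (R x) = R (C x)"
    if C: "C \<in> bops H H" and CA: "\<forall>x\<in>H. C (A x) = A (C x)" and x: "x \<in> H" for C x
  proof -
    have Cx: "C x \<in> H" using C x by (rule bops_mem)
    have "C (Y x) = Y (C x)"
    proof (rule LIMSEQ_unique)
      obtain M where M: "\<forall>x\<in>H. norm (C x) \<le> M * norm x" using bops_bound[OF C] by blast
      show "(\<lambda>n. sqrt_iter B n (C x)) \<longlonglongrightarrow> Y (C x)" using Cx by (rule lim)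
      have "(\<lambda>n. C (sqrt_iter B n x)) \<longlonglongrightarrow> C (Y x)"
      proof (rule LIM_zero_cancel, rule Lim_null_comparison)
        have "sqrt_iter B n x - Y x \<in> H" for n
          by (simp add: H hilbert_space_diff bops_mem[OF Y] sqrt_iter_mem[OF H B B_le] x)
        then show "\<forall>\<^sub>F n in sequentially.
            norm (C (sqrt_iter B n x) - C (Y x)) \<le> M * norm (sqrt_iter B n x - Y x)"
          using M by (simp flip: bops_diff[OF C H sqrt_iter_mem[OF H B B_le x] bops_mem[OF Y x]])
        show "(\<lambda>n. M * norm (sqrt_iter B n x - Y x)) \<longlonglongrightarrow> 0"
          by (rule tendsto_mult_right_zero) (use lim[OF x] LIM_zero tendsto_norm_zero in blast)
      qed
      moreover have "C (B u) = B (C u)" if "u \<in> H" for u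
        using that CA by (simp add: B_def bops_diff[OF C H] bops_mem[OF A_bops])
      ultimately show "(\<lambda>n. sqrt_iter B n (C x)) \<longlonglongrightarrow> C (Y x)"
        using sqrt_iter_commute[OF H B B_le C _ x] by simp
    qed
    then show ?thesis by (simp add: R_def bops_diff[OF C H x bops_mem[OF Y x]])
  qed
  ultimately show ?thesis by blast
qed

text \<open>Dividing by a bound M makes A a contraction, and the root obtained is scaled back by
  \<open>sqrt M\<close>.\<close>

lemma ex_positive_sqrt:
  assumes H: "hilbert_space H" and A: "positive_op H A"
  shows "\<exists>R. positive_op H R \<and> (\<forall>x\<in>H. R (R x) = A x) \<and>
    (\<forall>C\<in>bops H H. (\<forall>x\<in>H. C (A x) = A (C x)) \<longrightarrow> (\<forall>x\<in>H. C (R x) = R (C x)))"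
proof -
  note A_bops = positive_op_bops[OF A]
  have scale: "positive_op H (\<lambda>x. r *\<^sub>R T x)" if "0 \<le> r" and T: "positive_op H T" for r T
  proof (rule positive_opI)
    note T_bops = positive_op_bops[OF T]
    obtain M where M: "\<forall>x\<in>H. norm (T x) \<le> M * norm x" using bops_bound[OF T_bops] by blast
    have "norm (r *\<^sub>R T x) \<le> r * M * norm x" if "x \<in> H" for x
      using M that \<open>0 \<le> r\<close> by (simp add: mult_left_mono mult.assoc)
    then show "(\<lambda>x. r *\<^sub>R T x) \<in> bops H H"
      by (intro bopsI[where M = "r * M"]) (auto simp: H hilbert_space_intros bops_mem[OF T_bops]
          bops_add[OF T_bops] bops_scaleC[OF T_bops] scaleR_scaleC scaleR_add_right)
    show "cinner (r *\<^sub>R T x) x = cinner x (r *\<^sub>R T x)" if "x \<in> H" for x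
      using positive_op_hermitian[OF H T that that]
      by (simp add: cinner_scaleR_left cinner_scaleR_right)
    show "0 \<le> Re (cinner (r *\<^sub>R T x) x)" if "x \<in> H" for x
      using positive_op_nonneg[OF T that] \<open>0 \<le> r\<close> by (simp add: cinner_scaleR_left)
  qed
  obtain M where M: "0 < M" "\<And>x. x \<in> H \<Longrightarrow> norm (A x) \<le> M * norm x"
    using bops_bound[OF A_bops] by blast
  have "positive_op H (\<lambda>x. (1/M) *\<^sub>R A x)" using scale[of "1/M" A] M A by simp
  from ex_sqrt_contraction[OF H this] M obtain R where R: "positive_op H R"
    and R_sq: "\<And>x. x \<in> H \<Longrightarrow> R (R x) = (1/M) *\<^sub>R A x"
    and R_com: "\<And>C x. C \<in> bops H H \<Longrightarrow> (\<forall>x\<in>H. C ((1/M) *\<^sub>R A x) = (1/M) *\<^sub>R A (C x)) \<Longrightarrow>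
      x \<in> H \<Longrightarrow> C (R x) = R (C x)"
    by (auto simp: field_simps)
  note R_bops = positive_op_bops[OF R]
  show ?thesis
  proof (intro exI conjI ballI impI)
    show "positive_op H (\<lambda>x. sqrt M *\<^sub>R R x)" using scale[of "sqrt M" R] M R by simp
    show "sqrt M *\<^sub>R R (sqrt M *\<^sub>R R x) = A x" if "x \<in> H" for x
      using M that R_sq by (simp add: bops_scaleR[OF R_bops] bops_mem[OF R_bops])
    show "C (sqrt M *\<^sub>R R x) = sqrt M *\<^sub>R R (C x)"
      if "C \<in> bops H H" "\<forall>x\<in>H. C (A x) = A (C x)" "x \<in> H" for C x
      using R_com[of C x] that
      by (simp add: bops_scaleR[OF that(1)] bops_mem[OF R_bops] bops_mem[OF A_bops])
  qed
qed

text \<open>For y = R x - Q x commutation gives (R + Q) y = 0, so both nonnegative forms vanish at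
  y, whence R y = Q y = 0. Moving R and Q across \<open>cinner y y\<close> then gives y = 0.\<close>

lemma positive_sqrt_unique:
  assumes H: "hilbert_space H" and R: "positive_op H R" and Q: "positive_op H Q"
    and sq: "\<And>x. x \<in> H \<Longrightarrow> R (R x) = Q (Q x)" and com: "\<And>x. x \<in> H \<Longrightarrow> R (Q x) = Q (R x)"
    and x: "x \<in> H"
  shows "R x = Q x"
proof -
  note Rb = positive_op_bops[OF R] and Qb = positive_op_bops[OF Q]
  have mem: "R z \<in> H" "Q z \<in> H" if "z \<in> H" for z
    using that by (auto simp: bops_mem[OF Rb] bops_mem[OF Qb])
  define y where "y = R x - Q x"
  have y: "y \<in> H" using x by (simp add: y_def H hilbert_space_diff mem)
  have "R y + Q y = 0"
    using x by (simp add: y_def bops_diff[OF Rb H] bops_diff[OF Qb H] mem sq com)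
  then have "Re (cinner (R y) y) + Re (cinner (Q y) y) = 0"
    by (metis cinner_add_left cinner_zero_left plus_complex.simps(1) zero_complex.simps(1))
  then have "Re (cinner (R y) y) = 0" "Re (cinner (Q y) y) = 0"
    using positive_op_nonneg[OF R y] positive_op_nonneg[OF Q y] by linarith+
  then have "R y = 0" "Q y = 0"
    using positive_op_eq_0[OF H R y] positive_op_eq_0[OF H Q y] by auto
  then have "cinner y y = 0"
    using positive_op_hermitian[OF H R x y] positive_op_hermitian[OF H Q x y]
    by (subst (1) y_def) (simp add: cinner_diff_left)
  then show ?thesis by (simp add: y_def)
qed

text \<open>The description in \<open>op_sqrt\<close> is met by the constructed root Q, made
  extensional by restriction. A competing root R commutes with A = R R, hence with Q by the
  commutation property of Q, and so the uniqueness argument applies.\<close>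

lemma
  assumes H: "hilbert_space H" and A: "positive_op H A"
  shows op_sqrt_positive: "positive_op H (op_sqrt H A)"
    and op_sqrt_square: "\<And>x. x \<in> H \<Longrightarrow> op_sqrt H A (op_sqrt H A x) = A x"
    and op_sqrt_commute: "\<And>C x. C \<in> bops H H \<Longrightarrow> (\<And>x. x \<in> H \<Longrightarrow> C (A x) = A (C x)) \<Longrightarrow> x \<in> H \<Longrightarrow>
      C (op_sqrt H A x) = op_sqrt H A (C x)"
    and op_sqrt_eqI: "\<And>R. R \<in> extensional H \<Longrightarrow> positive_op H R \<Longrightarrow>
      (\<And>x. x \<in> H \<Longrightarrow> R (R x) = A x) \<Longrightarrow> op_sqrt H A = R"
proof -
  obtain Q where Q: "positive_op H Q" and Q_sq: "\<And>x. x \<in> H \<Longrightarrow> Q (Q x) = A x"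
    and Q_com: "\<And>C x. C \<in> bops H H \<Longrightarrow> (\<forall>x\<in>H. C (A x) = A (C x)) \<Longrightarrow> x \<in> H \<Longrightarrow> C (Q x) = Q (C x)"
    using ex_positive_sqrt[OF H A] by blast
  define P where "P = restrict Q H"
  have mem: "Q x \<in> H" if "x \<in> H" for x using bops_mem[OF positive_op_bops[OF Q] that] .
  have P: "P \<in> extensional H" "positive_op H P" "\<forall>x\<in>H. P (P x) = A x"
    using mem Q_sq by (auto simp: P_def positive_op_restrict[OF Q H])
  have uniq: "R = P" if R: "R \<in> extensional H" "positive_op H R" "\<forall>x\<in>H. R (R x) = A x" for R
  proof (rule extensionalityI[OF R(1) P(1)])
    fix x assume x: "x \<in> H"
    have Rb: "R \<in> bops H H" using R(2) by (rule positive_op_bops)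
    have "\<forall>x\<in>H. R (A x) = A (R x)" using R(3) bops_mem[OF Rb] by metis
    then have "R x = Q x"
      using Q_com[OF Rb] R(3) Q_sq by (intro positive_sqrt_unique[OF H R(2) Q _ _ x]) auto
    then show "R x = P x" using x by (simp add: P_def)
  qed
  have eq: "op_sqrt H A = P"
    unfolding op_sqrt_def by (rule the_equality) (use P uniq in blast)+
  show "positive_op H (op_sqrt H A)"
    "\<And>x. x \<in> H \<Longrightarrow> op_sqrt H A (op_sqrt H A x) = A x"
    using P by (auto simp: eq)
  show "op_sqrt H A = R" if "R \<in> extensional H" "positive_op H R" "\<And>x. x \<in> H \<Longrightarrow> R (R x) = A x" for R
    using uniq that eq by simp
  show "C (op_sqrt H A x) = op_sqrt H A (C x)"
    if "C \<in> bops H H" "\<And>x. x \<in> H \<Longrightarrow> C (A x) = A (C x)" "x \<in> H" for C x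
    using Q_com[of C x] that bops_mem[OF that(1,3)] by (simp add: eq P_def)
qed

section \<open>The modulus of a bounded operator\<close>

context
  fixes H :: "'a::complex_inner set" and K :: "'b::complex_inner set" and E :: "'a \<Rightarrow> 'b"
  assumes H: "hilbert_space H" and K: "hilbert_space K" and E: "E \<in> bops H K"
begin

lemma positive_op_adj_comp: "positive_op H (adj H K E \<circ> E)"
proof (rule positive_opI)
  have A: "adj H K E \<in> bops K H" by (rule adj_bops[OF H K E])
  obtain M where M: "0 < M" "\<forall>x\<in>H. norm (E x) \<le> M * norm x" using bops_bound[OF E] by blast
  obtain M' where M': "0 < M'" "\<forall>x\<in>K. norm (adj H K E x) \<le> M' * norm x"
    using bops_bound[OF A] by blast
  show "adj H K E \<circ> E \<in> bops H H"
  proof (rule bopsI[where M = "M' * M"])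
    show "norm ((adj H K E \<circ> E) x) \<le> M' * M * norm x" if "x \<in> H" for x
    proof -
      have "norm ((adj H K E \<circ> E) x) \<le> M' * norm (E x)" using M' bops_mem[OF E that] by simp
      also have "\<dots> \<le> M' * (M * norm x)" using M M' that by (intro mult_left_mono) auto
      finally show ?thesis by (simp add: mult.assoc)
    qed
  qed (auto simp: bops_mem[OF E] bops_mem[OF A] bops_add[OF E] bops_add[OF A] bops_scaleC[OF E]
      bops_scaleC[OF A])
  fix x assume x: "x \<in> H"
  then show "cinner ((adj H K E \<circ> E) x) x = cinner x ((adj H K E \<circ> E) x)"
    by (simp add: cinner_adj_left[OF H E] cinner_adj_right[OF H E] bops_mem[OF E])
  show "0 \<le> Re (cinner ((adj H K E \<circ> E) x) x)"
    using x by (simp add: cinner_adj_left[OF H E] bops_mem[OF E] cinner_self)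
qed

lemmas op_abs_positive = op_sqrt_positive[OF H positive_op_adj_comp, folded op_abs_def]
lemmas op_abs_square = op_sqrt_square[OF H positive_op_adj_comp, folded op_abs_def, unfolded o_apply]
lemmas op_abs_commute = op_sqrt_commute[OF H positive_op_adj_comp, folded op_abs_def, unfolded o_apply]
lemmas op_abs_bops = positive_op_bops[OF op_abs_positive]

lemma op_abs_hermitian:
  "x \<in> H \<Longrightarrow> y \<in> H \<Longrightarrow> cinner (op_abs H K E x) y = cinner x (op_abs H K E y)"
  by (rule positive_op_hermitian[OF H op_abs_positive])

text \<open>E and its modulus have values of equal norm at every vector of H.\<close>

lemma op_abs_eq_0_iff: "x \<in> H \<Longrightarrow> op_abs H K E x = 0 \<longleftrightarrow> E x = 0"
proof -
  assume x: "x \<in> H"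
  have "cinner (op_abs H K E x) (op_abs H K E x) = cinner (E x) (E x)"
    using x bops_mem[OF op_abs_bops x] bops_mem[OF E x]
    by (simp add: op_abs_hermitian op_abs_square cinner_adj_right[OF H E])
  then show ?thesis by (metis cinner_self_eq_0)
qed

end

text \<open>The adjoint of a restriction to L is the adjoint followed by the projection onto L. The
  adjoint at E x is the modulus applied twice to x, so it already lies in L. The restricted modulus
  is then the positive root, by uniqueness.\<close>

lemma
  assumes H: "hilbert_space H" and K: "hilbert_space K" and E: "E \<in> bops H K"
    and L: "hilbert_space L" "L \<subseteq> H" and inv: "\<And>x. x \<in> L \<Longrightarrow> op_abs H K E x \<in> L"
  shows adj_restrict_comp: "\<And>x. x \<in> L \<Longrightarrow> adj L K (restrict E L) (E x) = adj H K E (E x)"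
    and op_abs_restrict: "op_abs L K (restrict E L) = restrict (op_abs H K E) L"
proof -
  note sq = op_abs_square[OF H K E]
  have E': "restrict E L \<in> bops L K" using bops_mem[OF E] L by (intro bops_restrict[OF E]) auto
  show *: "adj L K (restrict E L) (E x) = adj H K E (E x)" if "x \<in> L" for x
  proof (rule adj_eqI[OF L(1) E'])
    show "E x \<in> K" using bops_mem[OF E] that L by auto
    then show "cinner (restrict E L h) (E x) = cinner h (adj H K E (E x))" if "h \<in> L" for h
      using that L by (auto simp: cinner_adj_right[OF H E])
    show "adj H K E (E x) \<in> L" using inv sq that L by (metis subsetD)
  qed
  show "op_abs L K (restrict E L) = restrict (op_abs H K E) L"
    unfolding op_abs_def[of L]
  proof (rule op_sqrt_eqI[OF L(1) positive_op_adj_comp[OF L(1) K E']])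
    show "positive_op L (restrict (op_abs H K E) L)"
      by (rule positive_op_restrict[OF op_abs_positive[OF H K E] L inv])
    show "restrict (op_abs H K E) L (restrict (op_abs H K E) L x) =
        (adj L K (restrict E L) \<circ> restrict E L) x" if "x \<in> L" for x
      using that inv sq L * by auto
  qed simp
qed

section \<open>Reducing subspaces and lifts\<close>

lemma ocomp_ocomp:
  assumes "hilbert_space H" "hilbert_space L" "L \<subseteq> H"
  shows "ocomp H (ocomp H L) = L"
  by (rule orth_decomp_ocomp_eq[OF orth_decomp_sym[OF orth_decomp_ocomp[OF assms]], symmetric])

lemma orth_decomp_subset:
  assumes "orth_decomp H L M"
  shows "L \<subseteq> H" "M \<subseteq> H"
  using orth_decomp_ocomp_eq[OF assms] orth_decomp_ocomp_eq[OF orth_decomp_sym[OF assms]]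
  by (auto simp: ocomp_def)

lemma orth_decomp_disjoint: "orth_decomp H L M \<Longrightarrow> x \<in> L \<Longrightarrow> x \<in> M \<Longrightarrow> x = 0"
  using cinner_self_eq_0[of x] unfolding orth_decomp_def by blast

lemma reduces_subset: "reduces K A L \<Longrightarrow> L \<subseteq> K"
  and reduces_hilbert_space: "reduces K A L \<Longrightarrow> hilbert_space L"
  and reduces_mem: "reduces K A L \<Longrightarrow> x \<in> L \<Longrightarrow> A x \<in> L"
  by (auto simp: reduces_iff)

lemma reduces_ocomp:
  assumes "hilbert_space K" "reduces K A L"
  shows "reduces K A (ocomp K L)"
  using assms ocomp_ocomp[OF assms(1), of L] hilbert_space_ocomp[OF assms(1), of L]
  by (auto simp: reduces_iff ocomp_def)

lemma reduces_orth_decomp: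
  assumes "orth_decomp K L M" "\<And>x. x \<in> L \<Longrightarrow> A x \<in> L" "\<And>x. x \<in> M \<Longrightarrow> A x \<in> M"
  shows "reduces K A L"
  using assms orth_decomp_ocomp_eq[OF assms(1)] orth_decomp_subset[OF assms(1)]
  by (auto simp: reduces_iff orth_decomp_def)

lemma reduces_adj_mem:
  "hilbert_space K \<Longrightarrow> A \<in> bops K K \<Longrightarrow> reduces K A L \<Longrightarrow> x \<in> L \<Longrightarrow> adj K K A x \<in> L"
  by (auto simp: reduces_iff_adj)

lemma reduces_restrict_bops:
  "A \<in> bops K K \<Longrightarrow> reduces K A L \<Longrightarrow> restrict A L \<in> bops L L"
  by (intro bops_restrict) (auto simp: reduces_iff)

lemma adj_restrict_reduces:
  assumes K: "hilbert_space K" and A: "A \<in> bops K K" and L: "reduces K A L" and y: "y \<in> L"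
  shows "adj L L (restrict A L) y = adj K K A y"
proof (rule adj_eqI[OF reduces_hilbert_space[OF L] reduces_restrict_bops[OF A L] y])
  show "adj K K A y \<in> L" using reduces_adj_mem[OF K A L y] .
  show "cinner (restrict A L h) y = cinner h (adj K K A y)" if "h \<in> L" for h
    using that cinner_adj_right[OF K A, of y h] y reduces_subset[OF L] by (simp add: subset_iff)
qed

lemma normal_op_restrict:
  assumes K: "hilbert_space K" and N: "normal_op K N" and L: "reduces K N L"
  shows "normal_op L (restrict N L)"
proof -
  have Nb: "N \<in> bops K K" using N by (simp add: normal_op_def)
  have "x \<in> L \<Longrightarrow> adj K K N (N x) = N (adj K K N x)" for x
    using N reduces_subset[OF L] by (auto simp: normal_op_def)
  then show ?thesis
    using reduces_restrict_bops[OF Nb L] reduces_mem[OF L] reduces_adj_mem[OF K Nb L]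
    by (auto simp: normal_op_def adj_restrict_reduces[OF K Nb L])
qed

lemma reduces_trans:
  assumes K: "hilbert_space K" and A: "A \<in> bops K K" and L: "reduces K A L"
    and M: "reduces L (restrict A L) M"
  shows "reduces K A M"
proof -
  note Lb = reduces_hilbert_space[OF L] reduces_restrict_bops[OF A L]
  have sub: "x \<in> L" if "x \<in> M" for x using reduces_subset[OF M] that by blast
  have "A x \<in> M" "adj K K A x \<in> M" if "x \<in> M" for x
    using reduces_mem[OF M that] reduces_adj_mem[OF Lb M that] sub[OF that]
    by (simp_all add: adj_restrict_reduces[OF K A L])
  then show ?thesis
    using reduces_hilbert_space[OF M] sub reduces_subset[OF L]
    unfolding reduces_iff_adj[OF K A] by blast
qed

lemma reduces_Int:
  assumes K: "hilbert_space K" and A: "A \<in> bops K K" and L: "reduces K A L" and M: "reduces K A M"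
  shows "reduces L (restrict A L) (L \<inter> M)"
proof -
  note LM = reduces_hilbert_space[OF L] reduces_hilbert_space[OF M]
  have "hilbert_space (L \<inter> M)"
    using LM hilbert_space_closed[OF LM(1)] hilbert_space_closed[OF LM(2)]
    by (intro hilbert_space_closed_subspace[OF LM(1)]) (auto simp: hilbert_space_intros)
  then show ?thesis
    using reduces_mem[OF L] reduces_mem[OF M] reduces_adj_mem[OF K A L] reduces_adj_mem[OF K A M]
      adj_restrict_reduces[OF K A L]
    by (auto simp: reduces_iff_adj[OF LM(1) reduces_restrict_bops[OF A L]])
qed

section \<open>Minimal normal extensions\<close>

text \<open>The intersection of L and M reduces the restriction of N to L and contains H, so
  minimality makes it all of L. Used in both directions, this identifies two decompositions.\<close>

lemma minimal_normal_extension_subset: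
  assumes K: "hilbert_space K" and N: "N \<in> bops K K"
    and min: "minimal_normal_extension H S L (restrict N L)"
    and L: "reduces K N L" and M: "reduces K N M" and "H \<subseteq> M"
  shows "L \<subseteq> M"
proof -
  have "H \<subseteq> L \<inter> M" using min \<open>H \<subseteq> M\<close> by (auto simp: minimal_normal_extension_def extends_def)
  then have "L \<inter> M = L"
    using min reduces_Int[OF K N L M] by (auto simp: minimal_normal_extension_def)
  then show ?thesis by blast
qed

text \<open>The zero subspace already reduces N. This settles the degenerate case of a vanishing
  summand.\<close>

lemma minimal_normal_extension_zero:
  assumes "minimal_normal_extension {0} S K N"
  shows "K = {0}"
proof -
  have K: "hilbert_space K" and N: "N \<in> bops K K" and zero: "hilbert_space {0 :: 'a}" "{0} \<subseteq> K"
    and minK: "\<And>L. {0} \<subseteq> L \<Longrightarrow> reduces K N L \<Longrightarrow> L = K"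
    using assms by (auto simp: minimal_normal_extension_def normal_op_def extends_def)
  have "reduces K N {0}"
    using zero by (auto simp: reduces_iff ocomp_def bops_zero[OF N K] bops_mem[OF N])
  then show ?thesis using minK by blast
qed

text \<open>If L contains H1 and reduces the restriction of N to K1, the remainder M of K1 is
  orthogonal to H1 and, lying in K1, also to H2 inside K2. The complement of M thus contains H and
  reduces N, so minimality of N forces M = {0}.\<close>

lemma minimal_normal_extension_restrict:
  assumes min: "minimal_normal_extension H S K N"
    and dH: "orth_decomp H H1 H2" and dK: "orth_decomp K K1 K2" and "H1 \<subseteq> K1" "H2 \<subseteq> K2"
    and inv: "\<And>x. x \<in> H1 \<Longrightarrow> S x \<in> H1" and K1: "reduces K N K1"
  shows "minimal_normal_extension H1 (restrict S H1) K1 (restrict N K1)"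
proof -
  have K: "hilbert_space K" and normal: "normal_op K N" and S: "S \<in> bops H H"
    and ext: "extends H S K N" and "\<And>L. H \<subseteq> L \<Longrightarrow> reduces K N L \<Longrightarrow> L = K"
    using min by (auto simp: minimal_normal_extension_def)
  note minK = this(5)
  have N: "N \<in> bops K K" using normal by (simp add: normal_op_def)
  note K1_hs = reduces_hilbert_space[OF K1]
  have H1: "hilbert_space H1" using dH by (simp add: orth_decomp_def)
  have "L = K1" if "H1 \<subseteq> L" and L: "reduces K1 (restrict N K1) L" for L
  proof -
    define M where "M = ocomp K1 L"
    have "reduces K1 (restrict N K1) M" unfolding M_def by (rule reduces_ocomp[OF K1_hs L])
    then have M: "reduces K N M" by (rule reduces_trans[OF K N K1])
    have "x \<in> ocomp K M" if "x \<in> H1 \<or> x \<in> H2" for x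
    proof -
      have "x \<in> K" using that \<open>H1 \<subseteq> K1\<close> \<open>H2 \<subseteq> K2\<close> orth_decomp_subset[OF dK] by auto
      moreover have "cinner m x = 0" if m: "m \<in> M" for m
      proof (cases "x \<in> H1")
        case True
        then show ?thesis using m \<open>H1 \<subseteq> L\<close> by (auto simp: M_def ocomp_def)
      next
        case False
        then show ?thesis
          using \<open>x \<in> H1 \<or> x \<in> H2\<close> \<open>H2 \<subseteq> K2\<close> m dK by (auto simp: M_def ocomp_def orth_decomp_def)
      qed
      ultimately show ?thesis using cinner_eq_0_sym by (auto simp: ocomp_def)
    qed
    then have "H \<subseteq> ocomp K M"
      using dH hilbert_space_add[OF hilbert_space_ocomp[OF K, of M]] by (auto simp: orth_decomp_def)
    then have "ocomp K M = K" by (rule minK[OF _ reduces_ocomp[OF K M]])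
    then have "x \<in> ocomp K M" if "x \<in> M" for x
      using that reduces_subset[OF M] by blast
    then have "M \<subseteq> {0}" unfolding ocomp_def using cinner_self_eq_0 by blast
    then have "ocomp K1 M = K1" unfolding ocomp_def using cinner_zero_right by blast
    then show "L = K1"
      using ocomp_ocomp[OF K1_hs reduces_hilbert_space[OF L] reduces_subset[OF L]] by (simp add: M_def)
  qed
  moreover have "restrict S H1 \<in> bops H1 H1"
    using bops_restrict[OF S H1 orth_decomp_subset(1)[OF dH] inv] .
  moreover have "extends H1 (restrict S H1) K1 (restrict N K1)"
    using ext \<open>H1 \<subseteq> K1\<close> orth_decomp_subset(1)[OF dH] by (auto simp: extends_def)
  ultimately show ?thesis
    using H1 K1_hs normal_op_restrict[OF K normal K1] by (auto simp: minimal_normal_extension_def)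
qed

text \<open>
  The difference \<open>C\<close> of two lifts of an operator commutes with \<open>N\<close> and its range is orthogonal to
  \<open>H\<close>. Hence the vectors orthogonal to all \<open>(N\<^sup>*)\<^sup>n C k\<close> form a reducing subspace of \<open>N\<close> that
  contains \<open>H\<close>. This avoids Fuglede's theorem.
\<close>

lemma lifts_unique:
  assumes min: "minimal_normal_extension H S K N"
    and B: "B \<in> lifts H A K N" and B': "B' \<in> lifts H A K N" and x: "x \<in> K"
  shows "B x = B' x"
proof -
  have H: "hilbert_space H" and K: "hilbert_space K" and normal: "normal_op K N"
    and S: "S \<in> bops H H" and ext: "extends H S K N"
    and "\<And>L. H \<subseteq> L \<Longrightarrow> reduces K N L \<Longrightarrow> L = K"
    using min by (auto simp: minimal_normal_extension_def)
  note minK = this(6)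
  have N: "N \<in> bops K K" using normal by (simp add: normal_op_def)
  have HK: "H \<subseteq> K" using ext by (simp add: extends_def)
  have Bs: "B \<in> bops K K" "B' \<in> bops K K"
    using B B' by (auto simp: lifts_def commutant_def)
  define C where "C k = B k - B' k" for k
  define Na where "Na = adj K K N"
  note Nb = adj_bops[OF K K N, folded Na_def]
  note cadj = cinner_adj_right[OF K N, folded Na_def] cinner_adj_left[OF K N, folded Na_def]
  have C_mem: "C k \<in> K" if "k \<in> K" for k
    using Bs that by (simp add: C_def K hilbert_space_diff bops_mem)
  have Na_mem: "(Na ^^ n) y \<in> K" if "y \<in> K" for n y
    using that by (induction n) (auto simp: bops_mem[OF Nb])
  have CN: "C (N k) = N (C k)" if "k \<in> K" for k
    using B B' that bops_diff[OF N K, of "B k" "B' k"] Bs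
    by (auto simp: lifts_def commutant_def C_def bops_mem)
  \<comment> \<open>A lift commutes with the projection, so its compression to H is A after the
    projection. Two lifts therefore have the same inner products with H.\<close>
  have lift_cinner: "cinner (T k) h = cinner (A (orth_proj K H k)) h"
    if T: "T \<in> lifts H A K N" and k: "k \<in> K" and h: "h \<in> H" for T k h
  proof -
    have "T k \<in> K" using T k by (auto simp: lifts_def commutant_def bops_mem)
    then have "cinner (T k) h = cinner (orth_proj K H (T k)) h"
      using orth_proj_orth[OF H _ h] by (simp add: cinner_diff_left)
    also have "orth_proj K H (T k) = T (orth_proj K H k)"
      using T k by (auto simp: lifts_def commutant_def)
    also have "\<dots> = A (orth_proj K H k)"
      using T orth_proj_mem[OF H k] by (auto simp: lifts_def extends_def)
    finally show ?thesis .
  qed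
  have C_orth: "cinner h (C k) = 0" if "h \<in> H" "k \<in> K" for h k
  proof (rule cinner_eq_0_sym)
    show "cinner (C k) h = 0"
      using lift_cinner[OF B that(2,1)] lift_cinner[OF B' that(2,1)]
      by (simp add: C_def cinner_diff_left)
  qed
  define L where "L = ocomp K {(Na ^^ n) (C k) | n k. k \<in> K}"
  have L_iff: "x \<in> L \<longleftrightarrow> x \<in> K \<and> (\<forall>n. \<forall>k\<in>K. cinner x ((Na ^^ n) (C k)) = 0)" for x
    by (auto simp: L_def ocomp_def)
  have "H \<subseteq> L"
  proof -
    have "cinner h ((Na ^^ n) (C k)) = 0" if "h \<in> H" "k \<in> K" for h k n
      using that(1)
    proof (induction n arbitrary: h)
      case (Suc n)
      \<comment> \<open>One adjoint moves to the left as N, and N h = S h stays in H, where the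
        induction hypothesis applies.\<close>
      have "N h \<in> H" using ext bops_mem[OF S Suc.prems] Suc.prems by (auto simp: extends_def)
      then show ?case
        using Suc HK that(2) by (auto simp: cadj Na_mem C_mem)
    qed (simp add: C_orth that)
    then show ?thesis using HK by (auto simp: L_iff)
  qed
  moreover have "reduces K N L"
    unfolding reduces_iff_adj[OF K N]
  proof (intro conjI image_subsetI)
    show "hilbert_space L" unfolding L_def by (rule hilbert_space_ocomp[OF K])
    show "L \<subseteq> K" by (auto simp: L_iff)
    fix y assume "y \<in> L"
    then have y: "y \<in> K" and orth: "\<And>n k. k \<in> K \<Longrightarrow> cinner y ((Na ^^ n) (C k)) = 0"
      by (auto simp: L_iff)
    have "cinner (N y) ((Na ^^ n) (C k)) = 0" if "k \<in> K" for n k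
      using orth[OF that, of "Suc n"] y that by (simp add: cadj Na_mem C_mem)
    then show "N y \<in> L" using y by (simp add: L_iff bops_mem[OF N])
    \<comment> \<open>Normality moves N through the powers of its adjoint to C k, and C commutes
      with N. So N maps the vectors defining L to vectors of the same kind, and the adjoint
      preserves L.\<close>
    have "N (Na z) = Na (N z)" if "z \<in> K" for z
      using normal that by (simp add: normal_op_def Na_def)
    then have "N ((Na ^^ n) z) = (Na ^^ n) (N z)" if "z \<in> K" for n z
      using that by (induction n) (simp_all add: Na_mem)
    then have "cinner (Na y) ((Na ^^ n) (C k)) = 0" if "k \<in> K" for n k
      using orth[OF bops_mem[OF N that], of n] y that by (simp add: cadj Na_mem C_mem CN)
    then show "adj K K N y \<in> L" using y bops_mem[OF Nb] by (simp add: L_iff flip: Na_def)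
  qed
  ultimately have "L = K" by (rule minK)
  then have "C x \<in> L" using C_mem[OF x] by simp
  then have "cinner (C x) ((Na ^^ 0) (C x)) = 0" using x unfolding L_iff by blast
  then show ?thesis by (simp add: C_def)
qed

text \<open>Taking adjoints in A S = S A gives the commutation with the adjoint of S, because A is
  its own adjoint. Moduli are Hermitian, so this covers them.\<close>

lemma commute_adj:
  assumes H: "hilbert_space H" and S: "S \<in> bops H H" and A: "A \<in> bops H H"
    and herm: "\<And>x y. x \<in> H \<Longrightarrow> y \<in> H \<Longrightarrow> cinner (A x) y = cinner x (A y)"
    and com: "\<And>x. x \<in> H \<Longrightarrow> A (S x) = S (A x)" and x: "x \<in> H"
  shows "A (adj H H S x) = adj H H S (A x)"
proof (rule hilbert_space_eqI[OF H])
  have mem: "adj H H S x \<in> H" using adj_mem[OF H S x] .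
  then show "A (adj H H S x) \<in> H" by (rule bops_mem[OF A])
  show "adj H H S (A x) \<in> H" using adj_mem[OF H S] bops_mem[OF A x] .
  show "cinner h (A (adj H H S x)) = cinner h (adj H H S (A x))" if "h \<in> H" for h
    using that x mem
    by (simp add: herm[symmetric] cinner_adj_right[OF H S] bops_mem[OF A] bops_mem[OF S] com[symmetric])
qed

text \<open>Commutation with N comes from the square root, uniqueness from
  \<open>lifts_unique\<close>. The larger modulus agrees on H with the smaller one, so it leaves H
  invariant; being Hermitian, it commutes with the projection onto H.\<close>

lemma is_lift_op_abs:
  fixes E :: "'b::complex_inner \<Rightarrow> 'a::complex_inner"
  assumes min: "minimal_normal_extension H S K N"
    and M: "hilbert_space M" "E \<in> bops H M" and M': "hilbert_space M'" "E' \<in> bops K M'"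
    and ES: "\<And>x. x \<in> H \<Longrightarrow> S (adj H M E (E x)) = adj H M E (E (S x))"
    and EN: "\<And>x. x \<in> K \<Longrightarrow> N (adj K M' E' (E' x)) = adj K M' E' (E' (N x))"
    and ext: "extends H (op_abs H M E) K (op_abs K M' E')"
  shows "is_lift H S K N (op_abs H M E) (op_abs K M' E')"
proof -
  have H: "hilbert_space H" and K: "hilbert_space K" and N: "N \<in> bops K K"
    and S: "S \<in> bops H H" and HK: "H \<subseteq> K"
    using min by (auto simp: minimal_normal_extension_def normal_op_def extends_def)
  define A where "A = op_abs H M E"
  define B where "B = op_abs K M' E'"
  note A = op_abs_bops[OF H M, folded A_def] op_abs_hermitian[OF H M, folded A_def]
    op_abs_commute[OF H M S ES, folded A_def]
  note B = op_abs_bops[OF K M', folded B_def] op_abs_hermitian[OF K M', folded B_def]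
    op_abs_commute[OF K M' N EN, folded B_def]
  have AB: "\<And>h. h \<in> H \<Longrightarrow> B h = A h" using ext by (simp add: extends_def A_def B_def)
  have "A (adj H H S x) = adj H H S (A x)" if "x \<in> H" for x
    by (rule commute_adj[OF H S A(1,2) _ that]) (simp_all add: A(3))
  then have "A \<in> commutant H {S, adj H H S}" using A by (auto simp: commutant_def)
  moreover have "B (orth_proj K H x) = orth_proj K H (B x)" if x: "x \<in> K" for x
  proof (rule orth_proj_eqI[OF H bops_mem[OF B(1) x], symmetric])
    have P: "orth_proj K H x \<in> H" using orth_proj_mem[OF H x] .
    then show "B (orth_proj K H x) \<in> H" by (simp add: AB bops_mem[OF A(1)])
    fix h assume h: "h \<in> H"
    have "cinner (B x - B (orth_proj K H x)) h = cinner (x - orth_proj K H x) (A h)"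
      using P h HK x by (simp add: cinner_diff_left B(2) subsetD[OF HK] flip: AB)
    also have "\<dots> = 0" using orth_proj_orth[OF H x bops_mem[OF A(1) h]] .
    finally show "cinner (B x - B (orth_proj K H x)) h = 0" .
  qed
  then have "B \<in> lifts H A K N"
    using ext B by (auto simp: lifts_def commutant_def simp flip: A_def B_def)
  ultimately show ?thesis
    using min lifts_unique[OF min] unfolding is_lift_def A_def[symmetric] B_def[symmetric] by blast
qed

section \<open>Kernel and closed range of a Hermitian operator\<close>

lemma ocomp_closure: "ocomp H (closure L) = ocomp H L"
proof -
  have "closure L \<subseteq> {y. cinner x y = 0}" if "x \<in> ocomp H L" for x
  proof (rule closure_minimal)
    show "L \<subseteq> {y. cinner x y = 0}" using that by (auto simp: ocomp_def)
    have "{y. cinner x y = 0} = {y. cinner y x = 0}" using cinner_eq_0_sym by blast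
    then show "closed {y. cinner x y = 0}" using closed_cinner_eq_0 by simp
  qed
  then show ?thesis using closure_subset[of L] by (auto simp: ocomp_def)
qed

lemma closure_image_sequential:
  "x \<in> closure (f ` S) \<longleftrightarrow> (\<exists>g. (\<forall>n. g n \<in> S) \<and> (\<lambda>n. f (g n)) \<longlonglongrightarrow> x)"
  for f :: "'a \<Rightarrow> 'b::first_countable_topology"
proof
  assume "x \<in> closure (f ` S)"
  then obtain h where h: "\<And>n. h n \<in> f ` S" "h \<longlonglongrightarrow> x" by (auto simp: closure_sequential)
  then have "\<forall>n. \<exists>y. y \<in> S \<and> h n = f y" by blast
  from choice[OF this] obtain g where g: "\<And>n. g n \<in> S" "h = (\<lambda>n. f (g n))" by blast
  then show "\<exists>g. (\<forall>n. g n \<in> S) \<and> (\<lambda>n. f (g n)) \<longlonglongrightarrow> x" using h(2) by blast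
next
  assume "\<exists>g. (\<forall>n. g n \<in> S) \<and> (\<lambda>n. f (g n)) \<longlonglongrightarrow> x"
  then obtain g where g: "\<And>n. g n \<in> S" "(\<lambda>n. f (g n)) \<longlonglongrightarrow> x" by blast
  then show "x \<in> closure (f ` S)"
    unfolding closure_sequential by (intro exI[of _ "\<lambda>n. f (g n)"]) simp
qed

lemma hilbert_space_closure_range:
  assumes H: "hilbert_space H" and A: "A \<in> bops H H"
  shows "hilbert_space (closure (A ` H))" "closure (A ` H) \<subseteq> H"
proof -
  show sub: "closure (A ` H) \<subseteq> H"
    using A hilbert_space_closed[OF H] by (intro closure_minimal) (auto simp: bops_def)
  show "hilbert_space (closure (A ` H))"
  proof (rule hilbert_space_closed_subspace[OF H _ sub])
    show "0 \<in> closure (A ` H)"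
      using bops_zero[OF A H] hilbert_space_zero[OF H] closure_subset by (metis image_eqI subsetD)
    show "x + y \<in> closure (A ` H)" if xy: "x \<in> closure (A ` H)" "y \<in> closure (A ` H)" for x y
    proof -
      obtain f g where f: "\<And>n. f n \<in> H" "(\<lambda>n. A (f n)) \<longlonglongrightarrow> x"
        and g: "\<And>n. g n \<in> H" "(\<lambda>n. A (g n)) \<longlonglongrightarrow> y"
        using xy unfolding closure_image_sequential by blast
      have "(\<lambda>n. A (f n + g n)) \<longlonglongrightarrow> x + y"
        using tendsto_add[OF f(2) g(2)] by (simp add: bops_add[OF A f(1) g(1)])
      then show ?thesis
        unfolding closure_image_sequential using f(1) g(1) hilbert_space_add[OF H]
        by (intro exI[of _ "\<lambda>n. f n + g n"]) simp
    qed
    show "a *\<^sub>C x \<in> closure (A ` H)" if x: "x \<in> closure (A ` H)" for a x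
    proof -
      obtain f where f: "\<And>n. f n \<in> H" "(\<lambda>n. A (f n)) \<longlonglongrightarrow> x"
        using x unfolding closure_image_sequential by blast
      have "(\<lambda>n. A (a *\<^sub>C f n)) \<longlonglongrightarrow> a *\<^sub>C x"
        using bounded_linear.tendsto[OF bounded_linear_scaleC f(2)] by (simp add: bops_scaleC[OF A f(1)])
      then show ?thesis
        unfolding closure_image_sequential using f(1) hilbert_space_scaleC[OF H]
        by (intro exI[of _ "\<lambda>n. a *\<^sub>C f n"]) simp
    qed
  qed simp
qed

context
  fixes H :: "'a::complex_inner set" and A :: "'a \<Rightarrow> 'a"
  assumes H: "hilbert_space H" and A: "A \<in> bops H H"
    and herm: "\<And>x y. x \<in> H \<Longrightarrow> y \<in> H \<Longrightarrow> cinner (A x) y = cinner x (A y)"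
begin

text \<open>For x orthogonal to the range, \<open>cinner (A x) (A x) = cinner x (A (A x))\<close>
  vanishes, so the complement of the range is the kernel.\<close>

lemma hermitian_orth_decomp: "orth_decomp H {x \<in> H. A x = 0} (closure (A ` H))"
proof -
  have "A x = 0" if "x \<in> ocomp H (A ` H)" for x
  proof -
    have x: "x \<in> H" and "cinner x (A (A x)) = 0"
      using that bops_mem[OF A] by (auto simp: ocomp_def)
    then have "cinner (A x) (A x) = 0" by (simp add: herm bops_mem[OF A])
    then show ?thesis by simp
  qed
  moreover have "x \<in> ocomp H (A ` H)" if "x \<in> H" "A x = 0" for x
    using herm[OF that(1), symmetric] that by (simp add: ocomp_def)
  ultimately have "ocomp H (A ` H) = {x \<in> H. A x = 0}"
    unfolding ocomp_def by blast
  then show ?thesis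
    using orth_decomp_sym[OF orth_decomp_ocomp[OF H hilbert_space_closure_range[OF H A]]]
    by (simp add: ocomp_closure)
qed

text \<open>Invariance of the kernel under the adjoint of S comes from \<open>commute_adj\<close>;
  the closed range is its complement.\<close>

lemma hermitian_reduces:
  assumes S: "S \<in> bops H H" and com: "\<And>x. x \<in> H \<Longrightarrow> S (A x) = A (S x)"
  shows "reduces H S {x \<in> H. A x = 0}" "reduces H S (closure (A ` H))"
proof -
  have "reduces H S {x \<in> H. A x = 0}"
    unfolding reduces_iff_adj[OF H S]
  proof (intro conjI image_subsetI)
    show "hilbert_space {x \<in> H. A x = 0}" using hermitian_orth_decomp by (simp add: orth_decomp_def)
    fix x assume x: "x \<in> {x \<in> H. A x = 0}"
    then show "S x \<in> {x \<in> H. A x = 0}"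
      using com[of x] by (simp add: bops_mem[OF S] bops_zero[OF S H])
    have "A (adj H H S x) = adj H H S (A x)"
      by (rule commute_adj[OF H S A herm]) (use x com in auto)
    then show "adj H H S x \<in> {x \<in> H. A x = 0}"
      using x by (simp add: adj_mem[OF H S] bops_zero[OF adj_bops[OF H H S] H])
  qed auto
  then show "reduces H S {x \<in> H. A x = 0}" "reduces H S (closure (A ` H))"
    using reduces_ocomp[OF H] orth_decomp_ocomp_eq[OF hermitian_orth_decomp] by auto
qed

lemma hermitian_kernel_range_mem:
  "x \<in> {x \<in> H. A x = 0} \<Longrightarrow> A x \<in> {x \<in> H. A x = 0}"
  "x \<in> closure (A ` H) \<Longrightarrow> A x \<in> closure (A ` H)"
proof -
  show "x \<in> {x \<in> H. A x = 0} \<Longrightarrow> A x \<in> {x \<in> H. A x = 0}"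
    by (simp add: bops_zero[OF A H] hilbert_space_zero[OF H])
  show "x \<in> closure (A ` H) \<Longrightarrow> A x \<in> closure (A ` H)"
    using hilbert_space_closure_range(2)[OF H A] closure_subset[of "A ` H"] by blast
qed

end

text \<open>The normal operator and the embedding chosen for H serve L unchanged.\<close>

lemma subnormal_restrict:
  assumes S: "subnormal H S" and L: "hilbert_space L" "L \<subseteq> H" and inv: "\<And>x. x \<in> L \<Longrightarrow> S x \<in> L"
  shows "subnormal L (restrict S L)"
proof -
  obtain K :: "'a ell2 set" and N J where K: "hilbert_space K" "normal_op K N"
    and J: "isometric_embedding H K J" and JS: "\<forall>h\<in>H. J (S h) = N (J h)"
    and Sb: "S \<in> bops H H"
    using S by (auto simp: subnormal_def)
  have J': "J \<in> bops H K" "\<And>h. h \<in> H \<Longrightarrow> norm (J h) = norm h"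
    using J by (auto simp: isometric_embedding_def)
  have "J \<in> bops L K"
    using L(2) by (intro bopsI[where M = 1])
      (simp_all add: subset_iff J' bops_mem[OF J'(1)] bops_add[OF J'(1)] bops_scaleC[OF J'(1)])
  then have "isometric_embedding L K J" using J' L(2) by (simp add: isometric_embedding_def subset_iff)
  moreover have "\<forall>h\<in>L. J (restrict S L h) = N (J h)" using JS L(2) by auto
  ultimately show ?thesis
    using K bops_restrict[OF Sb L inv] unfolding subnormal_def by blast
qed

section \<open>Brownian-type operators\<close>

lemma upper_mat_eq_iff: "upper_mat V E X = upper_mat V' E' X' \<longleftrightarrow> V = V' \<and> E = E' \<and> X = X'"
  by (simp add: upper_mat_def)

lemma mat_op_upper_mat: "mat_op (upper_mat V E X) = (\<lambda>(x, y). (V x + E y, X y))"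
  for X :: "_ \<Rightarrow> _ :: monoid_add"
  by (simp add: mat_op_def upper_mat_def)

lemma brownian_type0_iff:
  "upper_mat V E X \<in> brownian_type0 H1 H2 \<longleftrightarrow>
     hilbert_space H1 \<and> hilbert_space H2 \<and> H1 \<noteq> {0} \<and>
     mat_op (upper_mat V E X) \<in> bops (H1 \<times> H2) (H1 \<times> H2) \<and>
     (\<forall>x\<in>H1. adj H1 H1 V (V x) = x) \<and>
     (\<forall>y\<in>H2. adj H1 H1 V (E y) = 0) \<and>
     (\<forall>y\<in>H2. X (adj H2 H1 E (E y)) = adj H2 H1 E (E (X y)))"
  by (auto simp: brownian_type0_def upper_mat_eq_iff)

text \<open>
  Linearity of the matrix operator alone only makes \<open>V\<close> and \<open>E\<close> affine, with \<open>V 0 = - E 0\<close>. If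
  \<open>V 0 \<noteq> 0\<close>, then the defining property of \<open>adj H1 H1 V y\<close> is unsatisfiable unless \<open>y\<close> is orthogonal
  to \<open>V 0\<close>; the junk values of \<^const>\<open>adj\<close> then contradict \<open>adj H1 H1 V (V x) = x\<close>.
\<close>

lemma brownian_type0_zero:
  assumes br: "upper_mat V E X \<in> brownian_type0 H1 H2"
  shows "E 0 = 0" "V 0 = 0"
proof -
  note br = br[unfolded brownian_type0_iff]
  have H1: "hilbert_space H1" and H2: "hilbert_space H2" using br by auto
  have T: "mat_op (upper_mat V E X) \<in> bops (H1 \<times> H2) (H1 \<times> H2)" using br by blast
  have 0: "V 0 + E 0 = 0"
    using bops_scaleC[OF T, of "(0, 0)" 0] hilbert_space_zero[OF H1] hilbert_space_zero[OF H2]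
    by (simp add: mat_op_upper_mat scaleC_prod_def)
  have scale: "V (r *\<^sub>R x) + E 0 = r *\<^sub>R (V x + E 0)" if "x \<in> H1" for r x
    using bops_scaleC[OF T, of "(x, 0)" "of_real r"] that hilbert_space_zero[OF H2]
    by (simp add: mat_op_upper_mat scaleC_prod_def scaleC_of_real)
  \<comment> \<open>A description without solution evaluates to u, and \<open>restrict\<close>
    yields \<open>undefined\<close> outside its domain; these are the possible junk values of
    \<open>adj\<close>.\<close>
  define u where "u = (THE x :: 'a. False)"
  have orth: "cinner (V 0) (V z) = 0" if z: "z \<in> H1" "z \<noteq> u" "z \<noteq> undefined" for z
  proof (rule ccontr)
    assume ne: "cinner (V 0) (V z) \<noteq> 0"
    have eq: "adj H1 H1 V (V z) = z" using br z by blast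
    have unsat: "(x \<in> H1 \<and> (\<forall>h\<in>H1. cinner (V h) (V z) = cinner h x)) = False" for x
      using ne hilbert_space_zero[OF H1] by fastforce
    have "adj H1 H1 V (V z) \<in> {u, undefined}"
      unfolding adj_def restrict_def u_def by (simp only: unsat) simp
    then show False using eq z by auto
  qed
  obtain x where x: "x \<in> H1" "x \<noteq> 0" using br hilbert_space_zero[OF H1] by blast
  \<comment> \<open>A nonzero x has infinitely many multiples, so two of them avoid both junk
    values.\<close>
  have "inj (\<lambda>n. real n *\<^sub>R x)" using x by (auto intro: injI)
  then have "finite ((\<lambda>n. real n *\<^sub>R x) -` {u, undefined})" by (intro finite_vimageI) auto
  then have "infinite (- ((\<lambda>n. real n *\<^sub>R x) -` {u, undefined}))" by (simp add: finite_compl)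
  then obtain i where i: "real i *\<^sub>R x \<notin> {u, undefined}"
    and "infinite (- ((\<lambda>n. real n *\<^sub>R x) -` {u, undefined}) - {i})"
    by (metis ComplD infinite_imp_nonempty infinite_remove all_not_in_conv vimageI)
  then obtain j where j: "real j *\<^sub>R x \<notin> {u, undefined}" and "i \<noteq> j"
    by (metis (no_types, lifting) Diff_iff ComplD infinite_imp_nonempty all_not_in_conv vimageI singletonI)
  \<comment> \<open>V is affine along x with slope w. Orthogonality to V 0 at two different
    multiples kills the slope term and then the constant term.\<close>
  define w where "w = V x + E 0"
  have "of_real k * cinner (V 0) w = - cinner (V 0) (V 0)"
    if "real k *\<^sub>R x \<notin> {u, undefined}" for k
  proof -
    have "V (real k *\<^sub>R x) = real k *\<^sub>R w + V 0"
      using scale[OF x(1), of "real k"] 0 by (simp add: w_def add_eq_0_iff algebra_simps)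
    then show ?thesis
      using orth[of "real k *\<^sub>R x"] that x H1
      by (simp add: hilbert_space_scaleR cinner_add_right cinner_scaleR_right eq_neg_iff_add_eq_0)
  qed
  from this[OF i] this[OF j] \<open>i \<noteq> j\<close> have "cinner (V 0) w = 0"
    by (metis mult_cancel_right of_nat_eq_iff of_real_of_nat_eq)
  with \<open>of_real (real i) * cinner (V 0) w = - cinner (V 0) (V 0)\<close> have "cinner (V 0) (V 0) = 0"
    by simp
  then show "V 0 = 0" by simp
  then show "E 0 = 0" using 0 by simp
qed

text \<open>Evaluating the matrix at (0, y) isolates E and X once V 0 = 0 is known.\<close>

lemma brownian_type0_bops:
  assumes br: "upper_mat V E X \<in> brownian_type0 H1 H2"
  shows "E \<in> bops H2 H1" "X \<in> bops H2 H2"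
proof -
  have H: "hilbert_space H1" "hilbert_space H2"
    and T: "mat_op (upper_mat V E X) \<in> bops (H1 \<times> H2) (H1 \<times> H2)"
    using br by (auto simp: brownian_type0_iff)
  note zero = hilbert_space_zero[OF H(1)] brownian_type0_zero[OF br]
  obtain M where M: "\<forall>z\<in>H1 \<times> H2. norm (mat_op (upper_mat V E X) z) \<le> M * norm z"
    using bops_bound[OF T] by blast
  have bound: "norm (E y, X y) \<le> M * norm y" if "y \<in> H2" for y
    using bspec[OF M, of "(0, y)"] that zero by (simp add: mat_op_upper_mat)
  have add: "E (x + y) = E x + E y" "X (x + y) = X x + X y" if "x \<in> H2" "y \<in> H2" for x y
    using bops_add[OF T, of "(0, x)" "(0, y)"] that zero by (simp_all add: mat_op_upper_mat)
  have scale: "E (a *\<^sub>C y) = a *\<^sub>C E y" "X (a *\<^sub>C y) = a *\<^sub>C X y" if "y \<in> H2" for a y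
    using bops_scaleC[OF T, of "(0, y)" a] that zero
    by (simp_all add: mat_op_upper_mat scaleC_prod_def)
  have mem: "E y \<in> H1" "X y \<in> H2" if "y \<in> H2" for y
    using bops_mem[OF T, of "(0, y)"] that zero by (simp_all add: mat_op_upper_mat)
  show "E \<in> bops H2 H1"
    by (rule bopsI[where M = M])
      (use mem add scale order_trans[OF norm_fst_le bound] in auto)
  show "X \<in> bops H2 H2"
    by (rule bopsI[where M = M])
      (use mem add scale order_trans[OF norm_snd_le bound] in auto)
qed

text \<open>As L is invariant under the modulus of E, the adjoints of E and of its restriction agree
  at E y for y in L, so the commutation with X is inherited.\<close>

lemma brownian_type0_restrict:
  assumes br: "upper_mat V E X \<in> brownian_type0 H1 H2" and L: "hilbert_space L" "L \<subseteq> H2"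
    and X_inv: "\<And>x. x \<in> L \<Longrightarrow> X x \<in> L" and E_inv: "\<And>x. x \<in> L \<Longrightarrow> op_abs H2 H1 E x \<in> L"
  shows "upper_mat V (restrict E L) (restrict X L) \<in> brownian_type0 H1 L"
proof -
  note E = brownian_type0_bops(1)[OF br]
  note br = br[unfolded brownian_type0_iff]
  have H: "hilbert_space H2" "hilbert_space H1" using br by auto
  define T where "T = mat_op (upper_mat V E X)"
  define T' where "T' = mat_op (upper_mat V (restrict E L) (restrict X L))"
  have T: "T \<in> bops (H1 \<times> H2) (H1 \<times> H2)" using br by (simp add: T_def)
  obtain M where M: "\<forall>z\<in>H1 \<times> H2. norm (T z) \<le> M * norm z" using bops_bound[OF T] by blast
  have sub: "H1 \<times> L \<subseteq> H1 \<times> H2" using L by auto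
  have eq: "T' z = T z" if "z \<in> H1 \<times> L" for z
    using that by (auto simp: T_def T'_def mat_op_upper_mat)
  have "T' \<in> bops (H1 \<times> L) (H1 \<times> L)"
  proof (rule bopsI[where M = M])
    fix z w a assume z: "z \<in> H1 \<times> L"
    show "norm (T' z) \<le> M * norm z" using M z sub eq by auto
    have "T z \<in> H1 \<times> H2" using bops_mem[OF T] z sub by blast
    then show "T' z \<in> H1 \<times> L" using z X_inv eq[OF z] by (auto simp: T_def mat_op_upper_mat)
    have "a *\<^sub>C z \<in> H1 \<times> L" using z L H by (auto simp: scaleC_prod_def hilbert_space_scaleC)
    then show "T' (a *\<^sub>C z) = a *\<^sub>C T' z" using bops_scaleC[OF T, of z a] z sub eq by auto
    assume w: "w \<in> H1 \<times> L"
    have "z + w \<in> H1 \<times> L" using z w L H by (auto simp: hilbert_space_add)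
    then show "T' (z + w) = T' z + T' w" using bops_add[OF T, of z w] z w sub eq by auto
  qed
  moreover have "restrict X L (adj L H1 (restrict E L) (restrict E L y)) =
      adj L H1 (restrict E L) (restrict E L (restrict X L y))" if y: "y \<in> L" for y
  proof -
    note adj_eq = adj_restrict_comp[OF H E L E_inv]
    have "adj H2 H1 E (E y) \<in> L"
      using op_abs_square[OF H E, of y] y L(2) E_inv by (metis subsetD)
    then show ?thesis using y X_inv L(2) br by (auto simp: adj_eq)
  qed
  ultimately show ?thesis
    using br L by (auto simp: brownian_type0_iff T'_def)
qed

section \<open>Splitting the extension along the kernel and the closed range of the modulus\<close>

theorem theorem1p8:
  fixes H1 K1 :: "'a::complex_inner set" and H2 K2 H21 H22 :: "'b::complex_inner set"
    and V V' :: "'a \<Rightarrow> 'a" and E E' E1 E2 :: "'b \<Rightarrow> 'a" and S N S1 S2 :: "'b \<Rightarrow> 'b"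
  assumes "upper_mat V' E' N \<in> class_N K1 K2"
    and "upper_mat V E S \<in> class_S H1 H2"
    and "entrywise_ext H1 H2 (upper_mat V E S) K1 K2 (upper_mat V' E' N)"
    and "extends H2 (op_abs H2 H1 E) K2 (op_abs K2 K1 E')"
    and "minimal_normal_extension H2 S K2 N"
    and "H21 = {h \<in> H2. E h = 0}"
    and "H22 = closure (op_abs H2 H1 E ` H2)"
    and "E1 = restrict E H21" and "E2 = restrict E H22"
    and "S1 = restrict S H21" and "S2 = restrict S H22"
  shows "
    \<comment> \<open>(a)\<close>
    (reduces H2 S H21 \<and> subnormal H21 S1 \<and> reduces H2 S H22 \<and> subnormal H22 S2) \<and>
    \<comment> \<open>(b)\<close>
    (orth_decomp H2 H21 H22 \<and> op_sum H21 H22 S S1 S2) \<and>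
    \<comment> \<open>(c)\<close>
    ((\<forall>f1\<in>H21. \<forall>f2\<in>H22. E (f1 + f2) = E1 f1 + E2 f2) \<and>
     (\<forall>f\<in>H21. E1 f = 0) \<and> inj_on E2 H22) \<and>
    \<comment> \<open>existence and uniqueness of the decomposition\<close>
    (\<exists>!(L1, L2). min_normal_decomp H21 S1 H22 S2 K2 N L1 L2) \<and>
    (\<forall>K21 K22 N1 N2 E1' E2'.
       min_normal_decomp H21 S1 H22 S2 K2 N K21 K22 \<and>
       N1 = restrict N K21 \<and> N2 = restrict N K22 \<and>
       E1' = restrict E' K21 \<and> E2' = restrict E' K22 \<longrightarrow>
       \<comment> \<open>(d)\<close>
       (upper_mat V E1 S1 \<in> class_S0 H1 H21 \<and> upper_mat V E2 S2 \<in> class_S0 H1 H22 \<and>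
        upper_mat V' E1' N1 \<in> class_N0 K1 K21 \<and> upper_mat V' E2' N2 \<in> class_N0 K1 K22 \<and>
        (H21 = {0} \<longleftrightarrow> K21 = {0}) \<and> (H22 = {0} \<longleftrightarrow> K22 = {0})) \<and>
       \<comment> \<open>(e)\<close>
       (entrywise_ext H1 H21 (upper_mat V E1 S1) K1 K21 (upper_mat V' E1' N1) \<and>
        entrywise_ext H1 H22 (upper_mat V E2 S2) K1 K22 (upper_mat V' E2' N2)) \<and>
       \<comment> \<open>(f)\<close>
       (is_lift H21 S1 K21 N1 (op_abs H21 H1 E1) (op_abs K21 K1 E1') \<and>
        is_lift H22 S2 K22 N2 (op_abs H22 H1 E2) (op_abs K22 K1 E2') \<and>
        is_lift H2 S K2 N (op_abs H2 H1 E) (op_abs K2 K1 E') \<and>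
        extends H21 (op_abs H21 H1 E1) K21 (op_abs K21 K1 E1') \<and>
        extends H22 (op_abs H22 H1 E2) K22 (op_abs K22 K1 E2')) \<and>
       \<comment> \<open>(g)\<close>
       ((\<forall>x\<in>K21. E1' x = 0) \<and> inj_on E2' K22))"
proof -
  have br: "upper_mat V E S \<in> brownian_type0 H1 H2" and subnS: "subnormal H2 S"
    using assms(2) by (auto simp: class_S_def class_S0_def upper_mat_def)
  have br': "upper_mat V' E' N \<in> brownian_type0 K1 K2"
    using assms(1) by (auto simp: class_N_def class_N0_def)
  have ent: "H1 \<subseteq> K1" "H2 \<subseteq> K2" "\<And>h. h \<in> H1 \<Longrightarrow> V h = V' h" "\<And>h. h \<in> H2 \<Longrightarrow> E h = E' h"
    "\<And>h. h \<in> H2 \<Longrightarrow> S h = N h"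
    using assms(3) by (auto simp: entrywise_ext_def upper_mat_def)
  have H: "hilbert_space H2" "hilbert_space H1" and K: "hilbert_space K2" "hilbert_space K1"
    and ES: "\<And>y. y \<in> H2 \<Longrightarrow> S (adj H2 H1 E (E y)) = adj H2 H1 E (E (S y))"
    and EN: "\<And>y. y \<in> K2 \<Longrightarrow> N (adj K2 K1 E' (E' y)) = adj K2 K1 E' (E' (N y))"
    using br br' by (auto simp: brownian_type0_iff)
  note E = brownian_type0_bops(1)[OF br] and S = brownian_type0_bops(2)[OF br]
  note E' = brownian_type0_bops(1)[OF br'] and N = brownian_type0_bops(2)[OF br']
  define A where "A = op_abs H2 H1 E"
  define B where "B = op_abs K2 K1 E'"
  have AB: "\<And>h. h \<in> H2 \<Longrightarrow> A h = B h" using assms(4) by (simp add: extends_def A_def B_def)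
  note A = op_abs_bops[OF H E, folded A_def] op_abs_hermitian[OF H E, folded A_def]
  note B = op_abs_bops[OF K E', folded B_def] op_abs_hermitian[OF K E', folded B_def]
  have H21: "H21 = {x \<in> H2. A x = 0}" using assms(6) op_abs_eq_0_iff[OF H E] by (auto simp: A_def)
  have H22: "H22 = closure (A ` H2)" using assms(7) by (simp add: A_def)
  define M1 where "M1 = {x \<in> K2. B x = 0}"
  define M2 where "M2 = closure (B ` K2)"
  have M1: "M1 = {x \<in> K2. E' x = 0}" using op_abs_eq_0_iff[OF K E'] by (auto simp: M1_def B_def)

  have dH: "orth_decomp H2 H21 H22" unfolding H21 H22 by (rule hermitian_orth_decomp[OF H(1) A])
  have dK: "orth_decomp K2 M1 M2" unfolding M1_def M2_def by (rule hermitian_orth_decomp[OF K(1) B])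
  have redS: "reduces H2 S H21" "reduces H2 S H22"
    unfolding H21 H22 using hermitian_reduces[OF H(1) A S] op_abs_commute[OF H E S ES]
    by (auto simp: A_def)
  have redN: "reduces K2 N M1" "reduces K2 N M2"
    unfolding M1_def M2_def using hermitian_reduces[OF K(1) B N] op_abs_commute[OF K E' N EN]
    by (auto simp: B_def)
  have A_inv: "x \<in> H21 \<Longrightarrow> A x \<in> H21" "x \<in> H22 \<Longrightarrow> A x \<in> H22" for x
    unfolding H21 H22 by (rule hermitian_kernel_range_mem[OF H(1) A]; simp)+
  have B_inv: "x \<in> M1 \<Longrightarrow> B x \<in> M1" "x \<in> M2 \<Longrightarrow> B x \<in> M2" for x
    unfolding M1_def M2_def by (rule hermitian_kernel_range_mem[OF K(1) B]; simp)+
  have sub: "H21 \<subseteq> M1" "H22 \<subseteq> M2"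
  proof -
    show "H21 \<subseteq> M1" using ent(2) AB by (auto simp: H21 M1_def)
    have "A ` H2 \<subseteq> B ` K2" using ent(2) AB by auto
    then show "H22 \<subseteq> M2" unfolding H22 M2_def by (rule closure_mono)
  qed
  have hs: "hilbert_space H21" "hilbert_space H22" "hilbert_space M1" "hilbert_space M2"
    using dH dK by (auto simp: orth_decomp_def)
  note subH = orth_decomp_subset[OF dH] and subK = orth_decomp_subset[OF dK]

  have min: "minimal_normal_extension H21 S1 M1 (restrict N M1)"
    "minimal_normal_extension H22 S2 M2 (restrict N M2)"
    unfolding assms(10,11)
    using minimal_normal_extension_restrict[OF assms(5) dH dK sub reduces_mem[OF redS(1)] redN(1)]
      minimal_normal_extension_restrict[OF assms(5) orth_decomp_sym[OF dH] orth_decomp_sym[OF dK]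
        sub(2,1) reduces_mem[OF redS(2)] redN(2)] by auto
  have decomp: "min_normal_decomp H21 S1 H22 S2 K2 N M1 M2"
    using dK min reduces_restrict_bops[OF N redN(1)] reduces_restrict_bops[OF N redN(2)] subK
      bops_add[OF N]
    by (auto simp: min_normal_decomp_def op_sum_def subset_iff)
  have uniq: "L1 = M1 \<and> L2 = M2" if L: "min_normal_decomp H21 S1 H22 S2 K2 N L1 L2" for L1 L2
  proof -
    have d: "orth_decomp K2 L1 L2"
      and bops: "restrict N L1 \<in> bops L1 L1" "restrict N L2 \<in> bops L2 L2"
      and minL: "minimal_normal_extension H21 S1 L1 (restrict N L1)"
        "minimal_normal_extension H22 S2 L2 (restrict N L2)"
      using L by (auto simp: min_normal_decomp_def op_sum_def)
    \<comment> \<open>\<open>op_sum\<close> makes both summands invariant under N; as they are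
      complementary, each of them reduces N.\<close>
    have inv: "x \<in> L1 \<Longrightarrow> N x \<in> L1" "x \<in> L2 \<Longrightarrow> N x \<in> L2" for x
      using bops_mem[OF bops(1), of x] bops_mem[OF bops(2), of x] by auto
    have red: "reduces K2 N L1" "reduces K2 N L2"
      using reduces_orth_decomp[OF d] reduces_orth_decomp[OF orth_decomp_sym[OF d]] inv by auto
    have "H21 \<subseteq> L1" "H22 \<subseteq> L2"
      using minL by (auto simp: minimal_normal_extension_def extends_def)
    then show ?thesis
      using minimal_normal_extension_subset[OF K(1) N min(1) redN(1) red(1)]
        minimal_normal_extension_subset[OF K(1) N min(2) redN(2) red(2)]
        minimal_normal_extension_subset[OF K(1) N minL(1) red(1) redN(1) sub(1)]
        minimal_normal_extension_subset[OF K(1) N minL(2) red(2) redN(2) sub(2)] by blast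
  qed

  have invS: "x \<in> H21 \<Longrightarrow> S x \<in> H21" "x \<in> H22 \<Longrightarrow> S x \<in> H22" for x
    using reduces_mem redS by blast+
  have subn: "subnormal H21 S1" "subnormal H22 S2"
    unfolding assms(10,11) using subnormal_restrict[OF subnS hs(1) subH(1) invS(1)]
      subnormal_restrict[OF subnS hs(2) subH(2) invS(2)] by auto
  have a: "reduces H2 S H21 \<and> subnormal H21 S1 \<and> reduces H2 S H22 \<and> subnormal H22 S2"
    using redS subn by blast
  have b: "orth_decomp H2 H21 H22 \<and> op_sum H21 H22 S S1 S2"
    using dH reduces_restrict_bops[OF S redS(1)] reduces_restrict_bops[OF S redS(2)] subH bops_add[OF S]
    by (auto simp: op_sum_def assms(10,11) subset_iff)
  \<comment> \<open>Two points with equal image differ by an element of the kernel L1 that also lies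
    in L2, hence by 0. A general F covers both E and E'.\<close>
  have inj: "inj_on (restrict F L2) L2"
    if "orth_decomp L L1 L2" "F \<in> bops L M" "hilbert_space L" "L1 = {x \<in> L. F x = 0}"
    for F :: "'b \<Rightarrow> 'a" and L L1 L2 M
  proof (rule inj_onI)
    fix x y assume xy: "x \<in> L2" "y \<in> L2" "restrict F L2 x = restrict F L2 y"
    have L2: "hilbert_space L2" using that(1) by (simp add: orth_decomp_def)
    have "x \<in> L" "y \<in> L" using xy orth_decomp_subset[OF that(1)] by auto
    then have "x - y \<in> L1"
      using xy that by (simp add: bops_diff[OF that(2,3)] hilbert_space_diff)
    then have "x - y = 0"
      using hilbert_space_diff[OF L2 xy(1,2)] by (rule orth_decomp_disjoint[OF that(1)])
    then show "x = y" by simp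
  qed
  have c: "(\<forall>f1\<in>H21. \<forall>f2\<in>H22. E (f1 + f2) = E1 f1 + E2 f2) \<and> (\<forall>f\<in>H21. E1 f = 0) \<and> inj_on E2 H22"
  proof (intro conjI ballI)
    show "E (f1 + f2) = E1 f1 + E2 f2" if "f1 \<in> H21" "f2 \<in> H22" for f1 f2
      using bops_add[OF E] that subH by (simp add: assms(8,9) subset_iff)
    show "E1 f = 0" if "f \<in> H21" for f
      using that by (simp add: assms(8)) (simp add: assms(6))
    show "inj_on E2 H22" unfolding assms(9) by (rule inj[OF dH E H(1) assms(6)])
  qed
  have ex1: "\<exists>!(L1, L2). min_normal_decomp H21 S1 H22 S2 K2 N L1 L2"
  proof (rule ex1I[of _ "(M1, M2)"])
    show "case (M1, M2) of (L1, L2) \<Rightarrow> min_normal_decomp H21 S1 H22 S2 K2 N L1 L2"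
      using decomp by simp
    show "p = (M1, M2)" if "case p of (L1, L2) \<Rightarrow> min_normal_decomp H21 S1 H22 S2 K2 N L1 L2" for p
      using that uniq[of "fst p" "snd p"] by (simp add: case_prod_beta prod_eq_iff)
  qed

  define N1 N2 where "N1 = restrict N M1" and "N2 = restrict N M2"
  define E1' E2' where "E1' = restrict E' M1" and "E2' = restrict E' M2"
  note rdefs = assms(8-11) N1_def N2_def E1'_def E2'_def
  note invN = reduces_mem[OF redN(1)] reduces_mem[OF redN(2)]
  have br_j: "upper_mat V E1 S1 \<in> brownian_type0 H1 H21" "upper_mat V E2 S2 \<in> brownian_type0 H1 H22"
    "upper_mat V' E1' N1 \<in> brownian_type0 K1 M1" "upper_mat V' E2' N2 \<in> brownian_type0 K1 M2"
    unfolding rdefs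
    by (rule brownian_type0_restrict[OF br hs(1) subH(1) invS(1) A_inv(1)[unfolded A_def]]
        brownian_type0_restrict[OF br hs(2) subH(2) invS(2) A_inv(2)[unfolded A_def]]
        brownian_type0_restrict[OF br' hs(3) subK(1) invN(1) B_inv(1)[unfolded B_def]]
        brownian_type0_restrict[OF br' hs(4) subK(2) invN(2) B_inv(2)[unfolded B_def]]; assumption)+
  \<comment> \<open>Minimality over {0} gives one implication; for the other, each small space lies
    in the large one and contains 0.\<close>
  have triv: "H21 = {0} \<longleftrightarrow> M1 = {0}" "H22 = {0} \<longleftrightarrow> M2 = {0}"
    using minimal_normal_extension_zero min sub hilbert_space_zero[OF hs(1)] hilbert_space_zero[OF hs(2)] by blast+
  have d: "upper_mat V E1 S1 \<in> class_S0 H1 H21 \<and> upper_mat V E2 S2 \<in> class_S0 H1 H22 \<and>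
      upper_mat V' E1' N1 \<in> class_N0 K1 M1 \<and> upper_mat V' E2' N2 \<in> class_N0 K1 M2 \<and>
      (H21 = {0} \<longleftrightarrow> M1 = {0}) \<and> (H22 = {0} \<longleftrightarrow> M2 = {0})"
    using br_j subn triv min
    by (simp add: class_S0_def class_N0_def minimal_normal_extension_def N1_def N2_def)
      (simp add: upper_mat_def)
  have e: "entrywise_ext H1 H21 (upper_mat V E1 S1) K1 M1 (upper_mat V' E1' N1) \<and>
      entrywise_ext H1 H22 (upper_mat V E2 S2) K1 M2 (upper_mat V' E2' N2)"
    using ent sub subH by (auto simp: entrywise_ext_def upper_mat_def rdefs subset_iff)

  have abs_H: "op_abs H21 H1 E1 = restrict A H21" "op_abs H22 H1 E2 = restrict A H22"
    unfolding rdefs A_def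
    by (rule op_abs_restrict[OF H E hs(1) subH(1) A_inv(1)[unfolded A_def]]
        op_abs_restrict[OF H E hs(2) subH(2) A_inv(2)[unfolded A_def]]; assumption)+
  have abs_K: "op_abs M1 K1 E1' = restrict B M1" "op_abs M2 K1 E2' = restrict B M2"
    unfolding rdefs B_def
    by (rule op_abs_restrict[OF K E' hs(3) subK(1) B_inv(1)[unfolded B_def]]
        op_abs_restrict[OF K E' hs(4) subK(2) B_inv(2)[unfolded B_def]]; assumption)+
  have ext: "extends H21 (op_abs H21 H1 E1) M1 (op_abs M1 K1 E1')"
    "extends H22 (op_abs H22 H1 E2) M2 (op_abs M2 K1 E2')"
    using sub subH AB by (auto simp: abs_H abs_K extends_def subset_iff)
  \<comment> \<open>The Brownian-type condition supplies the commutation hypotheses of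
    \<open>is_lift_op_abs\<close>, for both summands and for the undecomposed spaces alike.\<close>
  have lift: "is_lift L T M R (op_abs L H1 F) (op_abs M K1 F')"
    if "minimal_normal_extension L T M R" "upper_mat V F T \<in> brownian_type0 H1 L"
      "upper_mat V' F' R \<in> brownian_type0 K1 M" "extends L (op_abs L H1 F) M (op_abs M K1 F')"
    for L M T R F F'
    using is_lift_op_abs[OF that(1) H(2) brownian_type0_bops(1)[OF that(2)] K(2)
        brownian_type0_bops(1)[OF that(3)] _ _ that(4)] that(2,3)
    by (simp add: brownian_type0_iff)
  have f: "is_lift H21 S1 M1 N1 (op_abs H21 H1 E1) (op_abs M1 K1 E1') \<and>
      is_lift H22 S2 M2 N2 (op_abs H22 H1 E2) (op_abs M2 K1 E2') \<and>
      is_lift H2 S K2 N (op_abs H2 H1 E) (op_abs K2 K1 E') \<and>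
      extends H21 (op_abs H21 H1 E1) M1 (op_abs M1 K1 E1') \<and>
      extends H22 (op_abs H22 H1 E2) M2 (op_abs M2 K1 E2')"
    using lift[OF min(1)[folded N1_def] br_j(1,3) ext(1)] lift[OF min(2)[folded N2_def] br_j(2,4) ext(2)]
      lift[OF assms(5) br br' assms(4)] ext by blast
  have g: "(\<forall>x\<in>M1. E1' x = 0) \<and> inj_on E2' M2"
  proof (intro conjI ballI)
    show "E1' x = 0" if "x \<in> M1" for x
      using that by (simp add: E1'_def) (simp add: M1)
    show "inj_on E2' M2" unfolding E2'_def by (rule inj[OF dK E' K(1) M1])
  qed

  show ?thesis
  proof (intro conjI[OF a conjI[OF b conjI[OF c conjI[OF ex1]]]] allI impI, elim conjE)
    \<comment> \<open>By uniqueness the given decomposition is M1, M2, so the facts collected above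
      transfer by rewriting.\<close>
    fix K21 K22 N1a N2a E1a E2a
    assume L: "min_normal_decomp H21 S1 H22 S2 K2 N K21 K22" and "N1a = restrict N K21"
      "N2a = restrict N K22" "E1a = restrict E' K21" "E2a = restrict E' K22"
    then have "K21 = M1" "K22 = M2" "N1a = N1" "N2a = N2" "E1a = E1'" "E2a = E2'"
      using uniq[OF L] by (simp_all add: N1_def N2_def E1'_def E2'_def)
    then show "(upper_mat V E1 S1 \<in> class_S0 H1 H21 \<and> upper_mat V E2 S2 \<in> class_S0 H1 H22 \<and>
        upper_mat V' E1a N1a \<in> class_N0 K1 K21 \<and> upper_mat V' E2a N2a \<in> class_N0 K1 K22 \<and>
        (H21 = {0} \<longleftrightarrow> K21 = {0}) \<and> (H22 = {0} \<longleftrightarrow> K22 = {0})) \<and>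
       (entrywise_ext H1 H21 (upper_mat V E1 S1) K1 K21 (upper_mat V' E1a N1a) \<and>
        entrywise_ext H1 H22 (upper_mat V E2 S2) K1 K22 (upper_mat V' E2a N2a)) \<and>
       (is_lift H21 S1 K21 N1a (op_abs H21 H1 E1) (op_abs K21 K1 E1a) \<and>
        is_lift H22 S2 K22 N2a (op_abs H22 H1 E2) (op_abs K22 K1 E2a) \<and>
        is_lift H2 S K2 N (op_abs H2 H1 E) (op_abs K2 K1 E') \<and>
        extends H21 (op_abs H21 H1 E1) K21 (op_abs K21 K1 E1a) \<and>
        extends H22 (op_abs H22 H1 E2) K22 (op_abs K22 K1 E2a)) \<and>
       ((\<forall>x\<in>K21. E1a x = 0) \<and> inj_on E2a K22)"
      using d e f g by simp
  qed
qed

end
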